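(* Let $D\ge 0$ and $N\ge 1$ be integers, and let the graph with nested triangulation $T_{D,N}$ have arbitrary nonnegative interchange rates (weights) on its edges such that the graph remains connected after removing all zero-rate edges. Then Aldous' conjecture holds for this weighted graph: the spectral gap of the interchange process on it equals the spectral gap of the random walk on it.
   Context: Graphs $T_{i,N}$: $T_{0,N}=K_3$ is the complete graph on 3 vertices. Given $T_{i,N}$, for each cycle of length 3 (triangle) that is present in $T_{i,N}$ but not in $T_{i-1,N}$ (for $i=0$: for the single triangle of $T_{0,N}$), add $N$ new vertices, each joined by 3 new edges to the three vertices of that triangle; the resulting graph is $T_{i+1,N}$. Spectral gaps: number the vertices $1,\ldots,n$ and let $\alpha_{ij}=\alpha_{ji}\ge0$ be the weight of edge $(i,j)$, with $\alpha_{ij}=0$ if $(i,j)$ is not an edge. The random-walk Laplacian $\mathcal L_n^{RW}(\alpha)$ is the $n\times n$ matrix with $(i,j)$ entry $-\alpha_{ij}$ for $i\neq j$ and $(j,j)$ entry $\sum_{k\neq j}\alpha_{kj}$. The interchange Laplacian $\mathcal L_n^I(\alpha)$ is the $n!\times n!$ matrix indexed by the symmetric group $\mathcal S_n$ with entry $(\sigma,\sigma')$ equal to $-\alpha_{ij}$ if $\sigma'=(ij)\sigma$ for a transposition $(ij)$, $\sum_{1\le \ell<m\le n}\alpha_{\ell m}$ if $\sigma=\sigma'$, and $0$ otherwise. The spectral gap of the random walk (respectively interchange process) is the second smallest eigenvalue, counted with multiplicity, of $\mathcal L_n^{RW}(\alpha)$ (respectively $\mathcal L_n^I(\alpha)$).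 *)

theory Defs
  imports
    "Jordan_Normal_Form.Char_Poly"
    "HOL-Library.FSet"
    "HOL-Combinatorics.Transposition"
begin

text \<open>
  A graph is a pair of a vertex set and a set of two-element sets of vertices. The vertex
  \<open>Nested t k\<close> is the \<open>k\<close>-th vertex added inside the triangle \<open>t\<close>. Each triangle is new
  in exactly one of the graphs below, so these vertices are fresh when they are added.
\<close>

datatype vertex = Corner nat | Nested "vertex fset" nat

type_synonym graph = "vertex set \<times> vertex set set"

definition triangles :: "graph \<Rightarrow> vertex fset set" where
  "triangles G = {t. fcard t = 3 \<and> (\<forall>u v. u |\<in>| t \<and> v |\<in>| t \<and> u \<noteq> v \<longrightarrow> {u, v} \<in> snd G)}"

definition add_nested :: "nat \<Rightarrow> vertex fset set \<Rightarrow> graph \<Rightarrow> graph" where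
  "add_nested N \<Delta> G =
    (fst G \<union> {Nested t k | t k. t \<in> \<Delta> \<and> k < N},
     snd G \<union> {{Nested t k, v} | t k v. t \<in> \<Delta> \<and> k < N \<and> v |\<in>| t})"

fun nested_triangulation :: "nat \<Rightarrow> nat \<Rightarrow> graph" where
  "nested_triangulation 0 N =
    ({Corner 0, Corner 1, Corner 2},
     {{Corner 0, Corner 1}, {Corner 0, Corner 2}, {Corner 1, Corner 2}})"
| "nested_triangulation (Suc 0) N =
    add_nested N (triangles (nested_triangulation 0 N)) (nested_triangulation 0 N)"
| "nested_triangulation (Suc (Suc i)) N =
    add_nested N
      (triangles (nested_triangulation (Suc i) N) - triangles (nested_triangulation i N))
      (nested_triangulation (Suc i) N)"

text \<open>Vertices and matrix indices are numbered from \<open>0\<close>.\<close>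

definition rw_laplacian :: "nat \<Rightarrow> (nat \<Rightarrow> nat \<Rightarrow> real) \<Rightarrow> real mat" where
  "rw_laplacian n \<alpha> =
    mat n n (\<lambda>(i, j). if i = j then (\<Sum>k\<in>{..<n} - {j}. \<alpha> k j) else - \<alpha> i j)"

text \<open>
  In the off-diagonal case at most one pair satisfies the condition, so the sum is \<open>\<alpha> i j\<close> if
  the second permutation is the transposition of \<open>i\<close> and \<open>j\<close> after the first one, and \<open>0\<close> if
  there is no such transposition.
\<close>

definition interchange_entry ::
  "nat \<Rightarrow> (nat \<Rightarrow> nat \<Rightarrow> real) \<Rightarrow> (nat \<Rightarrow> nat) \<Rightarrow> (nat \<Rightarrow> nat) \<Rightarrow> real" where
  "interchange_entry n \<alpha> \<sigma> \<sigma>' =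
    (if \<sigma> = \<sigma>' then \<Sum>(l, m) | l < m \<and> m < n. \<alpha> l m
     else - (\<Sum>(i, j) | i < j \<and> j < n \<and> \<sigma>' = transpose i j \<circ> \<sigma>. \<alpha> i j))"

text \<open>
  The argument \<open>\<pi>\<close> enumerates the permutations of \<open>{..<n}\<close> and turns the matrix indexed
  by permutations into a matrix indexed by numbers below \<open>n!\<close>.
\<close>

definition interchange_laplacian ::
  "nat \<Rightarrow> (nat \<Rightarrow> nat \<Rightarrow> real) \<Rightarrow> (nat \<Rightarrow> nat \<Rightarrow> nat) \<Rightarrow> real mat" where
  "interchange_laplacian n \<alpha> \<pi> =
    mat (fact n) (fact n) (\<lambda>(r, c). interchange_entry n \<alpha> (\<pi> r) (\<pi> c))"

text \<open>
  The second smallest eigenvalue, counted with multiplicity. Only real roots of the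
  characteristic polynomial enter; both Laplacians are symmetric for symmetric weights, so
  these are all of the roots. The matrix must have dimension at least \<open>2\<close>.
\<close>

definition spectral_gap :: "real mat \<Rightarrow> real" where
  "spectral_gap A = sorted_list_of_multiset (proots (char_poly A)) ! 1"

end

theory Submission
  imports
    Defs
    "Jordan_Normal_Form.Schur_Decomposition"
    "HOL-Combinatorics.Permutations"
begin

text \<open>
  The proof is the recursion of Caputo, Liggett and Richthammer. A nested triangulation can be
  dismantled by removing vertices whose remaining neighbours are at most three and pairwise
  adjacent. Removing a vertex \<open>v\<close> and adding \<open>c\<^sub>v\<^sub>x c\<^sub>v\<^sub>y / \<Sum> c\<^sub>v\<^sub>z\<close> to the rate of
  each pair of its neighbours does not decrease the gap of the random walk. By the octopus
  inequality, needed only for three legs, the Dirichlet form of the interchange process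
  dominates the form for the reduced rates in which the label at \<open>v\<close> is frozen. A function all
  of whose single-label marginals vanish has mean zero on each class of permutations with a
  given label at \<open>v\<close>, so induction applies to it; on the orthogonal complement the interchange
  process acts as the random walk of a single label.
\<close>

section \<open>Spectral theorem for real symmetric matrices\<close>

text \<open>The rates added on the neighbours of \<open>v\<close> follow the star-mesh rule, that
  is, the Schur complement eliminating \<open>v\<close> from the random-walk Laplacian; hence a
  function extended to \<open>v\<close> by its weighted average keeps its energy. The rule joins all
  pairs of neighbours of \<open>v\<close>, so on a general graph the degrees could grow during the
  dismantling, and octopus inequalities with arbitrarily many legs would be required. Here the
  neighbours are pairwise adjacent, the new rates fall on existing edges, and three legs suffice
  throughout. Together with \<open>v\<close> these are four points, and the inequality comes down to
  the Klein four-group being normal in the symmetric group on them. Everything is phrased through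
  one number \<open>r\<close>: to be a lower bound for a gap is a quadratic form inequality on
  functions of mean zero. This \<open>r\<close> is fixed during the recursion, which therefore
  handles neither eigenvectors nor matrices.\<close>

lemma conjugate_real_vec [simp]: "conjugate (v :: real vec) = v"
  by (rule eq_vecI) auto

definition orthogonal_real_mat :: "nat \<Rightarrow> real mat \<Rightarrow> bool" where
  "orthogonal_real_mat n W \<longleftrightarrow> W \<in> carrier_mat n n \<and> W\<^sup>T * W = 1\<^sub>m n \<and> W * W\<^sup>T = 1\<^sub>m n"

text \<open>Gram-Schmidt leaves the first basis vector \<open>v\<close> unchanged, so only the final
  normalisation touches it; this is the factor \<open>a\<close>.\<close>

lemma orthogonal_completion:
  fixes v :: "real vec"
  assumes v: "v \<in> carrier_vec n" and "v \<noteq> 0\<^sub>v n"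
  shows "\<exists>W a. orthogonal_real_mat n W \<and> col W 0 = a \<cdot>\<^sub>v v"
proof -
  interpret cof_vec_space n "TYPE(real)" .
  define b where "b = basis_completion v"
  define ws where "ws = gram_schmidt n b"
  from basis_completion[OF assms, folded b_def]
  have dist_b: "distinct b" and indep: "\<not> lin_dep (set b)" and b: "set b \<subseteq> carrier_vec n"
    and hdb: "hd b = v" and len_b: "length b = n" by auto
  have n: "n \<noteq> 0" using assms by (cases n) auto
  from hdb len_b n obtain vs where bv: "b = v # vs" by (cases b) auto
  from gram_schmidt_result[OF b dist_b indep refl, folded ws_def]
  have ws: "set ws \<subseteq> carrier_vec n" "corthogonal ws" "length ws = n"
    by (auto simp: len_b)
  have hdws: "hd ws = v"
    using gram_schmidt_hd[OF v, of vs, folded bv] unfolding ws_def .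
  have ws0: "ws ! 0 = v" using hdws ws(3) n by (cases ws) auto
  define u where "u i = (1 / sqrt (ws ! i \<bullet> ws ! i)) \<cdot>\<^sub>v (ws ! i)" for i
  define W where "W = mat_of_cols n (map u [0..<n])"
  have wsc: "ws ! i \<in> carrier_vec n" if "i < n" for i using ws that by auto
  have uc: "u i \<in> carrier_vec n" if "i < n" for i using wsc[OF that] unfolding u_def by auto
  have orth: "(ws ! i \<bullet> ws ! j = 0) = (i \<noteq> j)" if "i < n" "j < n" for i j
    using corthogonalD[OF ws(2), of i j] ws(3) that by simp
  have nonneg: "ws ! i \<bullet> ws ! i \<ge> 0" for i
    unfolding scalar_prod_def by (intro sum_nonneg) auto
  have uu: "u i \<bullet> u j = (if i = j then 1 else 0)" if "i < n" "j < n" for i j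
  proof -
    have "u i \<bullet> u j =
      (1 / sqrt (ws ! i \<bullet> ws ! i)) * ((1 / sqrt (ws ! j \<bullet> ws ! j)) * (ws ! i \<bullet> ws ! j))"
      unfolding u_def using wsc[OF that(1)] wsc[OF that(2)] by simp
    also have "\<dots> = (if i = j then 1 else 0)"
      using orth[OF that] nonneg[of i] by auto
    finally show ?thesis .
  qed
  have W: "W \<in> carrier_mat n n" unfolding W_def by auto
  have colW: "col W i = u i" if "i < n" for i
    unfolding W_def using that uc[OF that] by simp
  have WTW: "W\<^sup>T * W = 1\<^sub>m n"
    by (rule eq_matI) (use W uu colW in auto)
  have "W * W\<^sup>T = 1\<^sub>m n"
    using mat_mult_left_right_inverse[of "W\<^sup>T" n W] W WTW by auto
  moreover have "col W 0 = (1 / sqrt (ws ! 0 \<bullet> ws ! 0)) \<cdot>\<^sub>v v"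
    using colW[of 0] n ws0 by (simp add: u_def)
  ultimately show ?thesis
    using W WTW unfolding orthogonal_real_mat_def by blast
qed

text \<open>Deflation: in an orthonormal basis starting with an eigenvector for \<open>e\<close>,
  symmetry clears the first row along with the first column, and the remaining block is again
  symmetric. The diagonal follows the order of the given list, so a sorted list may be chosen
  later.\<close>

lemma real_symmetric_diagonalization:
  fixes A :: "real mat"
  assumes "A \<in> carrier_mat n n" and "A\<^sup>T = A"
    and "char_poly A = (\<Prod>e\<leftarrow>es. [:- e, 1:])"
  shows "\<exists>W. orthogonal_real_mat n W \<and>
    W\<^sup>T * A * W = mat n n (\<lambda>(i, j). if i = j then es ! i else 0)"
  using assms
proof (induction es arbitrary: n A)
  case Nil
  then have "n = 0" using degree_monic_char_poly[of A n] by auto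
  then show ?case using Nil(1)
    by (intro exI[of _ "1\<^sub>m 0"]) (auto simp: orthogonal_real_mat_def intro!: eq_matI)
next
  case (Cons e es n A)
  note A = Cons.prems(1) and sym = Cons.prems(2) and cp = Cons.prems(3)
  have "degree (char_poly A) = Suc (length es)"
    unfolding cp by (subst degree_linear_factors) simp
  with degree_monic_char_poly[OF A] obtain m where n: "n = Suc m" and m: "m = length es" by auto
  have "eigenvalue A e"
    unfolding eigenvalue_root_char_poly[OF A] cp by simp
  then obtain v where v: "v \<in> carrier_vec n" "v \<noteq> 0\<^sub>v n" and Av: "A *\<^sub>v v = e \<cdot>\<^sub>v v"
    using A unfolding eigenvalue_def eigenvector_def by auto
  from orthogonal_completion[OF v] obtain W a where
    oW: "orthogonal_real_mat n W" and cW: "col W 0 = a \<cdot>\<^sub>v v" by blast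
  then have W: "W \<in> carrier_mat n n" and WW: "W\<^sup>T * W = 1\<^sub>m n" "W * W\<^sup>T = 1\<^sub>m n"
    unfolding orthogonal_real_mat_def by auto
  have WT: "W\<^sup>T \<in> carrier_mat n n" using W by auto
  define B where "B = W\<^sup>T * A * W"
  have B: "B \<in> carrier_mat n n" unfolding B_def using W A by auto
  have symB: "B\<^sup>T = B"
    unfolding B_def using W A WT sym
    by (simp add: transpose_mult[of _ n n _ n] assoc_mult_mat[of _ n n _ n _ n])
  have AW: "A *\<^sub>v col W 0 = e \<cdot>\<^sub>v col W 0"
    unfolding cW using A v(1) Av by (simp add: mult_mat_vec smult_smult_assoc mult.commute)
  have B0: "B $$ (i, 0) = (if i = 0 then e else 0)" if "i < n" for i
  proof -
    have "B $$ (i, 0) = (W\<^sup>T * (A * W)) $$ (i, 0)"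
      unfolding B_def using W A WT by (simp add: assoc_mult_mat[of _ n n _ n _ n])
    also have "\<dots> = row W\<^sup>T i \<bullet> col (A * W) 0"
      using W A WT that n by auto
    also have "\<dots> = row W\<^sup>T i \<bullet> (A *\<^sub>v col W 0)"
      using W A n by (subst col_mult2[of A n n W n 0]) auto
    also have "\<dots> = e * (row W\<^sup>T i \<bullet> col W 0)"
      unfolding AW using W WT that by auto
    also have "row W\<^sup>T i \<bullet> col W 0 = (W\<^sup>T * W) $$ (i, 0)"
      using W WT that n by auto
    finally show ?thesis unfolding WW using that n by auto
  qed
  define C where "C = mat m m (\<lambda>(i, j). B $$ (Suc i, Suc j))"
  have C: "C \<in> carrier_mat m m" unfolding C_def by auto
  define E where "E = mat 1 1 (\<lambda>_. e)"
  have E: "E \<in> carrier_mat 1 1" unfolding E_def by auto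
  have B0': "B $$ (0, i) = (if i = 0 then e else 0)" if "i < n" for i
    using B0[OF that] arg_cong[OF symB, of "\<lambda>M. M $$ (0, i)"] B that n by auto
  have Bblock: "B = four_block_mat E (0\<^sub>m 1 m) (0\<^sub>m m 1) C"
    by (rule eq_matI) (use B E C n B0 B0' in \<open>auto simp: E_def C_def\<close>)
  have symC: "C\<^sup>T = C"
  proof (rule eq_matI)
    fix i j assume "i < dim_row C" "j < dim_col C"
    then have ij: "i < m" "j < m" using C by auto
    then have "B $$ (Suc j, Suc i) = B $$ (Suc i, Suc j)"
      using arg_cong[OF symB, of "\<lambda>M. M $$ (Suc i, Suc j)"] B n by auto
    then show "C\<^sup>T $$ (i, j) = C $$ (i, j)" using ij by (simp add: C_def)
  qed (use C in auto)
  have "similar_mat_wit B A W\<^sup>T W"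
    by (rule similar_mat_witI[of _ _ n]) (use W A WT WW B B_def in auto)
  then have "similar_mat B A" unfolding similar_mat_def by blast
  then have "char_poly B = char_poly A" by (rule char_poly_similar)
  moreover have "char_poly B = char_poly E * char_poly C"
    unfolding Bblock by (rule char_poly_four_block_zeros_col) (use E C in auto)
  moreover have "char_poly E = [:- e, 1:]"
    by (simp add: E_def char_poly_defs det_def sign_def)
  ultimately have "[:- e, 1:] * char_poly C = [:- e, 1:] * (\<Prod>e\<leftarrow>es. [:- e, 1:])"
    using cp by simp
  then have "char_poly C = (\<Prod>e\<leftarrow>es. [:- e, 1:])"
    by (simp only: mult_cancel_left) auto
  from Cons.IH[OF C symC this] obtain V where oV: "orthogonal_real_mat m V" and
    VC: "V\<^sup>T * C * V = mat m m (\<lambda>(i, j). if i = j then es ! i else 0)" by blast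
  then have V: "V \<in> carrier_mat m m" and VV: "V\<^sup>T * V = 1\<^sub>m m" "V * V\<^sup>T = 1\<^sub>m m"
    unfolding orthogonal_real_mat_def by auto
  define U where "U = four_block_mat (1\<^sub>m 1) (0\<^sub>m 1 m) (0\<^sub>m m 1) V"
  have U: "U \<in> carrier_mat n n" unfolding U_def using V n by auto
  have UT: "U\<^sup>T = four_block_mat (1\<^sub>m 1) (0\<^sub>m 1 m) (0\<^sub>m m 1) V\<^sup>T"
    unfolding U_def using V by (subst transpose_four_block_mat) auto
  have one: "four_block_mat (1\<^sub>m 1) (0\<^sub>m 1 m) (0\<^sub>m m 1) (1\<^sub>m m) = (1\<^sub>m n :: real mat)"
    unfolding n by (rule eq_matI) auto
  have UU: "U\<^sup>T * U = 1\<^sub>m n" "U * U\<^sup>T = 1\<^sub>m n"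
    unfolding UT unfolding U_def
    by (subst mult_four_block_mat[of _ 1 1 _ m _ m _ _ 1 _ m]; use V VV one in simp)+
  have UTc: "U\<^sup>T \<in> carrier_mat n n" using U by auto
  have UBU: "U\<^sup>T * B * U = mat n n (\<lambda>(i, j). if i = j then (e # es) ! i else 0)"
  proof -
    have "U\<^sup>T * B = four_block_mat E (0\<^sub>m 1 m) (0\<^sub>m m 1) (V\<^sup>T * C)"
      unfolding UT Bblock
      by (subst mult_four_block_mat[of _ 1 1 _ m _ m _ _ 1 _ m]; use V E C in simp)
    then have "U\<^sup>T * B * U = four_block_mat E (0\<^sub>m 1 m) (0\<^sub>m m 1) (V\<^sup>T * C * V)"
      unfolding U_def
      by (simp, subst mult_four_block_mat[of _ 1 1 _ m _ m _ _ 1 _ m]; use V E C in simp)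
    also have "\<dots> = mat n n (\<lambda>(i, j). if i = j then (e # es) ! i else 0)"
      unfolding VC E_def n by (rule eq_matI) auto
    finally show ?thesis .
  qed
  define X where "X = W * U"
  have X: "X \<in> carrier_mat n n" unfolding X_def using W U by auto
  have XT: "X\<^sup>T = U\<^sup>T * W\<^sup>T" unfolding X_def using W U by (rule transpose_mult)
  have "X\<^sup>T * X = U\<^sup>T * (W\<^sup>T * W) * U"
    unfolding XT unfolding X_def using W U WT UTc by (simp add: assoc_mult_mat[of _ n n _ n _ n])
  then have XX1: "X\<^sup>T * X = 1\<^sub>m n" using WW UU U UTc by simp
  have "X * X\<^sup>T = W * (U * U\<^sup>T) * W\<^sup>T"
    unfolding XT unfolding X_def using W U WT UTc by (simp add: assoc_mult_mat[of _ n n _ n _ n])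
  then have XX2: "X * X\<^sup>T = 1\<^sub>m n" using WW UU W WT by simp
  have "X\<^sup>T * A * X = U\<^sup>T * B * U"
    unfolding XT unfolding X_def B_def using W U WT UTc A
    by (simp add: assoc_mult_mat[of _ n n _ n _ n])
  then show ?case using X XX1 XX2 UBU unfolding orthogonal_real_mat_def by auto
qed

text \<open>Over the complex numbers a factorisation always exists. For an eigenvector
  \<open>v\<close> the Hermitian form \<open>q\<close> is \<open>e\<close> times the squared norm of
  \<open>v\<close>, and symmetry of the real matrix makes \<open>q\<close> its own conjugate, so
  \<open>e\<close> is real.\<close>

lemma real_symmetric_char_poly_splits:
  fixes A :: "real mat"
  assumes A: "A \<in> carrier_mat n n" and sym: "A\<^sup>T = A"
  shows "\<exists>es. char_poly A = (\<Prod>e\<leftarrow>es. [:- e, 1:])"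
proof -
  define M where "M = map_mat complex_of_real A"
  have M: "M \<in> carrier_mat n n" unfolding M_def using A by auto
  have symA: "A $$ (i, j) = A $$ (j, i)" if "i < n" "j < n" for i j
    using arg_cong[OF sym, of "\<lambda>B. B $$ (i, j)"] A that by auto
  have real: "Im e = 0" if "eigenvalue M e" for e
  proof -
    from that obtain v where v: "v \<in> carrier_vec n" "v \<noteq> 0\<^sub>v n" and Mv: "M *\<^sub>v v = e \<cdot>\<^sub>v v"
      using M unfolding eigenvalue_def eigenvector_def by auto
    define q where "q = (\<Sum>i<n. \<Sum>j<n. cnj (v $ i) * of_real (A $$ (i, j)) * v $ j)"
    have row: "(\<Sum>j<n. of_real (A $$ (i, j)) * v $ j) = e * v $ i" if "i < n" for i
    proof -
      have "(M *\<^sub>v v) $ i = (\<Sum>j<n. of_real (A $$ (i, j)) * v $ j)"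
        using that A v unfolding M_def by (auto simp: scalar_prod_def atLeast0LessThan)
      then show ?thesis unfolding Mv using that v by simp
    qed
    have "q = (\<Sum>i<n. cnj (v $ i) * (\<Sum>j<n. of_real (A $$ (i, j)) * v $ j))"
      unfolding q_def by (simp add: sum_distrib_left mult.assoc)
    also have "\<dots> = (\<Sum>i<n. e * of_real ((cmod (v $ i))\<^sup>2))"
      by (intro sum.cong refl, simp only: lessThan_iff row complex_norm_square) (simp only: ac_simps)
    finally have q: "q = e * of_real (\<Sum>i<n. (cmod (v $ i))\<^sup>2)"
      by (simp add: sum_distrib_left)
    have "cnj q = (\<Sum>i<n. \<Sum>j<n. v $ i * of_real (A $$ (i, j)) * cnj (v $ j))"
      unfolding q_def by (simp add: cnj_sum)
    also have "\<dots> = (\<Sum>j<n. \<Sum>i<n. v $ i * of_real (A $$ (i, j)) * cnj (v $ j))"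
      by (rule sum.swap)
    also have "\<dots> = q"
      unfolding q_def by (intro sum.cong refl) (auto simp: symA)
    finally have "Im q = 0" by (simp add: complex_eq_iff)
    moreover have "(\<Sum>i<n. (cmod (v $ i))\<^sup>2) \<noteq> 0"
    proof
      assume "(\<Sum>i<n. (cmod (v $ i))\<^sup>2) = 0"
      then have "\<forall>i<n. v $ i = 0" by (subst (asm) sum_nonneg_eq_0_iff) auto
      then have "v = 0\<^sub>v n" using v by (intro eq_vecI) auto
      with v show False by simp
    qed
    ultimately show ?thesis using q by simp
  qed
  obtain as where as: "char_poly M = (\<Prod>a\<leftarrow>as. [:- a, 1:])"
    using char_poly_factorized[OF M] by auto
  have asr: "of_real (Re a) = a" if "a \<in> set as" for a
  proof -
    have "poly (char_poly M) a = 0"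
      unfolding as using that by (simp add: poly_prod_list prod_list_zero_iff)
    then have "Im a = 0" using real eigenvalue_root_char_poly[OF M] by auto
    then show ?thesis by (simp add: complex_eq_iff)
  qed
  interpret hp: map_poly_inj_idom_hom complex_of_real ..
  have "map_poly complex_of_real (char_poly A) = char_poly M"
    unfolding M_def by (rule of_real_hom.char_poly_hom[OF A, symmetric])
  also have "\<dots> = (\<Prod>a\<leftarrow>as. map_poly complex_of_real [:- Re a, 1:])"
    unfolding as by (rule arg_cong[of _ _ prod_list], rule map_cong) (use asr in auto)
  also have "\<dots> = map_poly complex_of_real (\<Prod>e\<leftarrow>map Re as. [:- e, 1:])"
    by (simp add: hp.hom_prod_list o_def)
  finally have "char_poly A = (\<Prod>e\<leftarrow>map Re as. [:- e, 1:])"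
    by simp
  then show ?thesis by blast
qed

section \<open>Sorted eigenvalues and the spectral gap as a threshold\<close>

lemma proots_linear_factors: "proots (\<Prod>e\<leftarrow>es. [:- e, 1:]) = mset (es :: 'a::idom list)"
proof (induction es)
  case (Cons a es)
  have "(\<Prod>e\<leftarrow>es. [:- e, 1:]) \<noteq> 0" by (auto simp: prod_list_zero_iff)
  then have "proots ([:- a, 1:] * (\<Prod>e\<leftarrow>es. [:- e, 1:])) = {#a#} + mset es"
    by (subst proots_mult) (use Cons in auto)
  then show ?case by simp
qed simp

lemma real_symmetric_eigenvalues:
  fixes A :: "real mat"
  assumes A: "A \<in> carrier_mat n n" and sym: "A\<^sup>T = A"
  shows "\<exists>es W. sorted es \<and> length es = n \<and> proots (char_poly A) = mset es \<and>
    orthogonal_real_mat n W \<and> W\<^sup>T * A * W = mat n n (\<lambda>(i, j). if i = j then es ! i else 0)"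
proof -
  obtain fs where fs: "char_poly A = (\<Prod>e\<leftarrow>fs. [:- e, 1:])"
    using real_symmetric_char_poly_splits[OF assms] by blast
  define es where "es = sort fs"
  have es: "char_poly A = (\<Prod>e\<leftarrow>es. [:- e, 1:])"
    unfolding fs es_def by (simp flip: prod_mset_prod_list add: mset_map)
  have "length es = n"
    using degree_monic_char_poly[OF A] unfolding es by (subst (asm) degree_linear_factors) simp
  moreover have "proots (char_poly A) = mset es"
    unfolding es by (rule proots_linear_factors)
  ultimately show ?thesis
    using real_symmetric_diagonalization[OF A sym es] unfolding es_def
    by (intro exI[of _ "sort fs"]) auto
qed

text \<open>Courant-Fischer with the constants as a known bottom eigenvector. Describing the gap
  through all its lower bounds \<open>r\<close> allows the two processes to be compared by their
  forms alone.\<close>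

lemma le_spectral_gap_iff:
  fixes A :: "real mat"
  assumes A: "A \<in> carrier_mat n n" and n: "2 \<le> n" and sym: "A\<^sup>T = A"
    and psd: "\<And>f. f \<in> carrier_vec n \<Longrightarrow> 0 \<le> f \<bullet> (A *\<^sub>v f)"
    and ker: "A *\<^sub>v vec n (\<lambda>_. 1) = 0\<^sub>v n"
  shows "r \<le> spectral_gap A \<longleftrightarrow>
    (\<forall>f\<in>carrier_vec n. (\<Sum>i<n. f $ i) = 0 \<longrightarrow> r * (f \<bullet> f) \<le> f \<bullet> (A *\<^sub>v f))"
proof -
  obtain es W where es: "sorted es" "length es = n" "proots (char_poly A) = mset es"
    and oW: "orthogonal_real_mat n W"
    and D: "W\<^sup>T * A * W = mat n n (\<lambda>(i, j). if i = j then es ! i else 0)"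
    using real_symmetric_eigenvalues[OF A sym] by blast
  have W: "W \<in> carrier_mat n n" and WW: "W\<^sup>T * W = 1\<^sub>m n" "W * W\<^sup>T = 1\<^sub>m n"
    using oW unfolding orthogonal_real_mat_def by auto
  have WT: "W\<^sup>T \<in> carrier_mat n n" using W by auto
  have gap: "spectral_gap A = es ! 1"
    unfolding spectral_gap_def es(3) by (simp add: sorted_list_of_multiset_mset sorted_sort_id[OF es(1)])
  define g where "g f = W\<^sup>T *\<^sub>v f" for f
  have gc: "g f \<in> carrier_vec n" if "f \<in> carrier_vec n" for f unfolding g_def using that WT by auto
  have Wg: "W *\<^sub>v g f = f" if "f \<in> carrier_vec n" for f
    unfolding g_def using that W WT WW by (simp flip: assoc_mult_mat_vec)
  have gW: "g (W *\<^sub>v z) = z" if "z \<in> carrier_vec n" for z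
    unfolding g_def using that W WT WW by (simp flip: assoc_mult_mat_vec)
  have prod: "f \<bullet> h = g f \<bullet> g h" if "f \<in> carrier_vec n" "h \<in> carrier_vec n" for f h
  proof -
    have "f \<bullet> h = f \<bullet> (W *\<^sub>v g h)" by (simp add: Wg that)
    also have "\<dots> = (W\<^sup>T *\<^sub>v f) \<bullet> g h"
      using transpose_vec_mult_scalar[OF W gc[OF that(2)] that(1)] by simp
    finally show ?thesis unfolding g_def .
  qed
  have gA: "g (A *\<^sub>v f) $ k = es ! k * g f $ k" if f: "f \<in> carrier_vec n" and k: "k < n" for f k
  proof -
    have "g (A *\<^sub>v f) = g (A *\<^sub>v (W *\<^sub>v g f))" by (simp add: Wg f)
    also have "\<dots> = (W\<^sup>T * A * W) *\<^sub>v g f"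
      unfolding g_def[of "A *\<^sub>v _"] using W WT A gc[OF f]
      by (simp add: assoc_mult_mat_vec[of _ n n _ n])
    also have "\<dots> $ k = (\<Sum>i<n. (if k = i then es ! k else 0) * g f $ i)"
      unfolding D using k gc[OF f] by (simp add: scalar_prod_def atLeast0LessThan)
    also have "\<dots> = es ! k * g f $ k"
      using k by (subst sum.remove[of _ k]) (auto intro!: sum.neutral)
    finally show ?thesis .
  qed
  have norm: "f \<bullet> f = (\<Sum>k<n. (g f $ k)\<^sup>2)" if "f \<in> carrier_vec n" for f
    using gc[OF that] unfolding prod[OF that that]
    by (simp add: scalar_prod_def atLeast0LessThan power2_eq_square)
  have form: "f \<bullet> (A *\<^sub>v f) = (\<Sum>k<n. es ! k * (g f $ k)\<^sup>2)" if "f \<in> carrier_vec n" for f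
  proof -
    have "A *\<^sub>v f \<in> carrier_vec n" using A that by auto
    from gc[OF that] gc[OF this] show ?thesis
      unfolding prod[OF that \<open>A *\<^sub>v f \<in> carrier_vec n\<close>]
      by (auto simp: scalar_prod_def atLeast0LessThan power2_eq_square gA that intro!: sum.cong)
  qed
  have es0: "es ! k \<ge> 0" if "k < n" for k
  proof -
    have "0 \<le> (W *\<^sub>v unit_vec n k) \<bullet> (A *\<^sub>v (W *\<^sub>v unit_vec n k))"
      by (rule psd) (use W in auto)
    also have "\<dots> = (\<Sum>i<n. es ! i * (unit_vec n k $ i)\<^sup>2)"
      by (subst form) (use W in \<open>auto simp: gW\<close>)
    also have "\<dots> = es ! k"
      using that by (subst sum.remove[of _ k]) (auto simp: unit_vec_def intro!: sum.neutral)
    finally show ?thesis .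
  qed
  define one where "one = vec n (\<lambda>_. 1 :: real)"
  have one: "one \<in> carrier_vec n" unfolding one_def by auto
  define u where "u = g one"
  have u: "u \<in> carrier_vec n" unfolding u_def using gc one by auto
  \<comment> \<open>\<open>A\<close> annihilates the constants, so their coordinates
    \<open>u\<close> vanish at every nonzero eigenvalue.\<close>
  have esu: "es ! k * u $ k = 0" if "k < n" for k
    using gA[OF one that] ker that W WT unfolding u_def one_def g_def by auto
  have fu: "(\<Sum>i<n. f $ i) = (\<Sum>k<n. g f $ k * u $ k)" if "f \<in> carrier_vec n" for f
    using prod[OF that one] u unfolding u_def[symmetric] by (simp add: one_def scalar_prod_def atLeast0LessThan)
  have mono: "es ! i \<le> es ! j" if "i \<le> j" "j < n" for i j
    using es(1,2) that by (auto intro: sorted_nth_mono)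
  have split: "(\<Sum>k<n. F k) = F 0 + (\<Sum>k=1..<n. F k)" for F :: "nat \<Rightarrow> real"
    using n by (simp add: sum.atLeast_Suc_lessThan lessThan_atLeast0)
  show ?thesis
  proof (intro iffI ballI impI)
    fix f :: "real vec" assume le: "r \<le> spectral_gap A" and f: "f \<in> carrier_vec n" and f0: "(\<Sum>i<n. f $ i) = 0"
    show "r * (f \<bullet> f) \<le> f \<bullet> (A *\<^sub>v f)"
    proof (cases "es ! 1 = 0")
      case True
      \<comment> \<open>The kernel is at least two-dimensional here, and a function of mean zero may
        have energy 0; but \<open>r\<close> is at most 0 as well.\<close>
      then have "r * (f \<bullet> f) \<le> 0"
        using le unfolding gap norm[OF f] by (simp add: mult_nonpos_nonneg sum_nonneg)
      with psd[OF f] show ?thesis by linarith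
    next
      case False
      with es0[of 1] n have pos: "es ! 1 > 0" by auto
      \<comment> \<open>The eigenvalue 0 is simple here, so the constants lie along the eigenvector
        of index 0, and mean zero says that \<open>g f\<close> has no component there.\<close>
      have uk: "u $ k = 0" if "1 \<le> k" "k < n" for k
        using esu[OF that(2)] mono[OF that] pos by auto
      have "(\<Sum>i<n. one $ i) = real n" by (simp add: one_def)
      then have "u $ 0 * u $ 0 \<noteq> 0"
        using fu[OF one] n unfolding u_def[symmetric] split[of "\<lambda>k. u $ k * u $ k"]
        by (auto simp: uk)
      moreover have "g f $ 0 * u $ 0 = 0"
        using fu[OF f] f0 unfolding split by (simp add: uk)
      ultimately have g0: "g f $ 0 = 0" by auto
      have "r * (f \<bullet> f) = (\<Sum>k=1..<n. r * (g f $ k)\<^sup>2)"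
        unfolding norm[OF f] split by (simp add: g0 sum_distrib_left)
      also have "\<dots> \<le> (\<Sum>k=1..<n. es ! k * (g f $ k)\<^sup>2)"
        using le mono[of 1] unfolding gap by (intro sum_mono mult_right_mono) fastforce+
      also have "\<dots> = f \<bullet> (A *\<^sub>v f)" unfolding form[OF f] split by (simp add: g0)
      finally show ?thesis .
    qed
  next
    assume *: "\<forall>f\<in>carrier_vec n. (\<Sum>i<n. f $ i) = 0 \<longrightarrow> r * (f \<bullet> f) \<le> f \<bullet> (A *\<^sub>v f)"
    \<comment> \<open>The plane of the two lowest eigenvectors contains a nonzero vector orthogonal
      to the constants, and its Rayleigh quotient is at most \<open>es ! 1\<close>.\<close>
    have "\<exists>a b. a * u $ 0 + b * u $ 1 = 0 \<and> a\<^sup>2 + b\<^sup>2 > 0"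
    proof (cases "u $ 0 = 0 \<and> u $ 1 = 0")
      case True
      then show ?thesis by (intro exI[of _ 1] exI[of _ 0]) auto
    next
      case False
      then show ?thesis
        by (intro exI[of _ "u $ 1"] exI[of _ "- u $ 0"]) (auto simp: sum_power2_gt_zero_iff)
    qed
    then obtain a b where ab: "a * u $ 0 + b * u $ 1 = 0" "a\<^sup>2 + b\<^sup>2 > 0" by blast
    define z where "z = vec n (\<lambda>k. if k = 0 then a else if k = 1 then b else 0)"
    define f where "f = W *\<^sub>v z"
    have z: "z \<in> carrier_vec n" unfolding z_def by auto
    have f: "f \<in> carrier_vec n" unfolding f_def using z W by auto
    have gf: "g f = z" unfolding f_def by (rule gW[OF z])
    have two: "(\<Sum>k<n. F k) = F 0 + F 1" if "\<And>k. 2 \<le> k \<Longrightarrow> k < n \<Longrightarrow> F k = 0" for F :: "nat \<Rightarrow> real"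
    proof -
      have "(\<Sum>k<n. F k) = (\<Sum>k\<in>{0, 1}. F k)"
        by (rule sum.mono_neutral_right) (use n that in \<open>auto simp: less_2_cases_iff not_less\<close>)
      then show ?thesis by simp
    qed
    have zk: "z $ 0 = a" "z $ 1 = b" using n unfolding z_def by auto
    have z0: "z $ k = 0" if "2 \<le> k" "k < n" for k using that unfolding z_def by auto
    have "(\<Sum>i<n. f $ i) = a * u $ 0 + b * u $ 1"
      unfolding fu[OF f] gf by (subst two) (auto simp: zk[unfolded One_nat_def] z0)
    then have "r * (f \<bullet> f) \<le> f \<bullet> (A *\<^sub>v f)"
      using * f ab(1) by simp
    then have "r * (a\<^sup>2 + b\<^sup>2) \<le> es ! 0 * a\<^sup>2 + es ! 1 * b\<^sup>2"
      unfolding norm[OF f] form[OF f] gf by (subst (asm) (1 2) two) (auto simp: z0 zk simp del: One_nat_def)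
    also have "\<dots> \<le> es ! 1 * (a\<^sup>2 + b\<^sup>2)"
      using mono[of 0 1] n by (simp add: distrib_left mult_right_mono)
    finally show "r \<le> spectral_gap A" using ab(2) unfolding gap by simp
  qed
qed

section \<open>The octopus inequality with three legs\<close>

lemma sum_permutes_shift:
  assumes "g permutes V"
  shows "(\<Sum>\<sigma> | \<sigma> permutes V. F (g \<circ> \<sigma>)) = (\<Sum>\<sigma> | \<sigma> permutes V. F \<sigma>)"
  using setum_permutations_compose_left[OF assms, of F] by simp

locale permutation_function =
  fixes V :: "'a set" and f :: "('a \<Rightarrow> 'a) \<Rightarrow> real"
begin

text \<open>The inner product of \<open>f\<close> with its left translate by \<open>g\<close>.
  Elements of the group algebra enter only through their quadratic forms at \<open>f\<close>, which
  are linear combinations of values of \<open>\<phi>\<close>.\<close>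

definition \<phi> :: "('a \<Rightarrow> 'a) \<Rightarrow> real" where
  "\<phi> g = (\<Sum>\<sigma> | \<sigma> permutes V. f \<sigma> * f (g \<circ> \<sigma>))"

definition p :: "'a \<Rightarrow> 'a \<Rightarrow> real" where
  "p a b = \<phi> (Transposition.transpose a b)"

definition q :: "'a \<Rightarrow> 'a \<Rightarrow> 'a \<Rightarrow> 'a \<Rightarrow> real" where
  "q a b c d = \<phi> (Transposition.transpose a b \<circ> Transposition.transpose c d)"

lemma p_same [simp]: "p a a = \<phi> id"
  by (simp add: p_def)

lemma q_same [simp]: "q a b a b = \<phi> id"
  by (simp add: q_def)

lemma q_left_same [simp]: "q a a c d = p c d"
  by (simp add: q_def p_def)

lemma q_right_same [simp]: "q a b c c = p a b"
  by (simp add: q_def p_def)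

lemma p_commute: "p a b = p b a"
  by (simp add: p_def transpose_commute)

lemma q_commute: "q a b c d = q b a c d" "q a b c d = q a b d c"
  by (simp_all add: q_def transpose_commute)

lemma sum_p:
  assumes "a \<in> V" "b \<in> V"
  shows "(\<Sum>\<sigma> | \<sigma> permutes V. f \<sigma> * f (Transposition.transpose a b \<circ> \<sigma>)) = p a b"
    and "(\<Sum>\<sigma> | \<sigma> permutes V. f (Transposition.transpose a b \<circ> \<sigma>) * f \<sigma>) = p a b"
  by (simp_all add: p_def \<phi>_def mult.commute)

lemma sum_q:
  assumes "a \<in> V" "b \<in> V"
  shows "(\<Sum>\<sigma> | \<sigma> permutes V. f (Transposition.transpose a b \<circ> \<sigma>) * f (Transposition.transpose c d \<circ> \<sigma>))
    = q c d a b"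
proof -
  have "(\<Sum>\<sigma> | \<sigma> permutes V. f \<sigma> * f (Transposition.transpose c d \<circ> Transposition.transpose a b \<circ> \<sigma>))
     = (\<Sum>\<sigma> | \<sigma> permutes V. f (Transposition.transpose a b \<circ> \<sigma>) * f (Transposition.transpose c d \<circ> \<sigma>))"
    by (subst sum_permutes_shift[OF permutes_swap_id[OF assms], symmetric])
      (simp add: o_assoc[symmetric], simp add: o_assoc)
  then show ?thesis by (simp add: q_def \<phi>_def)
qed

text \<open>The two products are inverse to each other, and translating the sum shows that
  \<open>\<phi>\<close> agrees on them.\<close>

lemma q_sym:
  assumes "a \<in> V" "b \<in> V" "c \<in> V" "d \<in> V"
  shows "q a b c d = q c d a b"
  using sum_q[OF assms(1,2), of c d] sum_q[OF assms(3,4), of a b] by (simp add: mult.commute)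

text \<open>A product of two different transpositions of three points is one of the two three-cycles
  on them; these are mutually inverse, so \<open>\<phi>\<close> does not distinguish them.\<close>

lemma three_cycle:
  assumes V: "a \<in> V" "b \<in> V" "c \<in> V" and "a \<noteq> b" "a \<noteq> c" "b \<noteq> c"
  shows "q a b b c = q a b a c" "q b c a b = q a b a c"
    "q a c a b = q a b a c" "q a c b c = q a b a c" "q b c a c = q a b a c"
proof -
  have *: "Transposition.transpose a b \<circ> Transposition.transpose b c = Transposition.transpose a c \<circ> Transposition.transpose a b"
    "Transposition.transpose b c \<circ> Transposition.transpose a c = Transposition.transpose a b \<circ> Transposition.transpose b c"
    using assms by (auto simp: Transposition.transpose_def fun_eq_iff)
  have s: "q a c a b = q a b a c" "q b c a b = q a b b c" "q b c a c = q a c b c"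
    using V by (auto intro: q_sym)
  from * have "q a b b c = q a c a b" "q b c a c = q a b b c" by (simp_all add: q_def)
  with s show "q a b b c = q a b a c" "q b c a b = q a b a c"
    "q a c a b = q a b a c" "q a c b c = q a b a c" "q b c a c = q a b a c" by simp_all
qed

text \<open>
  Let \<open>K\<close> be the sum over the Klein four-group acting on the four points and let \<open>\<rho>\<close> be a
  three-cycle. The claim is \<open>\<parallel>(K - \<rho> K) f\<parallel>\<^sup>2 \<ge> 0\<close>.
\<close>

lemma klein_four_bound:
  assumes V: "v \<in> V" "x \<in> V" "z \<in> V" "w \<in> V"
    and ne: "v \<noteq> x" "v \<noteq> z" "v \<noteq> w" "x \<noteq> z" "x \<noteq> w" "z \<noteq> w"
  shows "q v x v z + q v x v w + q v z v w + q x z x w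
    \<le> \<phi> id + q v x z w + q v z x w + q v w x z"
proof -
  let ?t = Transposition.transpose
  define d1 d2 d3 r where d: "d1 = ?t v x \<circ> ?t z w" "d2 = ?t v z \<circ> ?t x w" "d3 = ?t v w \<circ> ?t x z"
    and r: "r = ?t v x \<circ> ?t x z"
  have perm: "d1 permutes V" "d2 permutes V" "d3 permutes V" "r permutes V"
    unfolding d r using V by (auto intro!: permutes_compose permutes_swap_id)
  have dd: "d1 \<circ> d1 = id" "d2 \<circ> d2 = id" "d3 \<circ> d3 = id"
    "d1 \<circ> d2 = d3" "d1 \<circ> d3 = d2" "d2 \<circ> d1 = d3" "d2 \<circ> d3 = d1" "d3 \<circ> d1 = d2" "d3 \<circ> d2 = d1"
    using ne unfolding d by (auto simp: Transposition.transpose_def fun_eq_iff)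
  \<comment> \<open>Conjugation by the three-cycle permutes the double transpositions cyclically:
    the four-group is normalised by \<open>r\<close>.\<close>
  have rd: "r \<circ> d1 = d3 \<circ> r" "r \<circ> d2 = d1 \<circ> r" "r \<circ> d3 = d2 \<circ> r"
    using ne unfolding d r by (auto simp: Transposition.transpose_def fun_eq_iff)
  \<comment> \<open>The coset of \<open>r\<close> consists of four three-cycles, one fixing each of
    the four points.\<close>
  have dr: "d1 \<circ> r = ?t x w \<circ> ?t z w" "d2 \<circ> r = ?t v w \<circ> ?t x w" "d3 \<circ> r = ?t v z \<circ> ?t z w"
    using ne unfolding d r by (auto simp: Transposition.transpose_def fun_eq_iff)
  have dd': "d \<circ> (d' \<circ> \<sigma>) = d'' \<circ> \<sigma>" if "d \<circ> d' = d''" for d d' d'' \<sigma> :: "'a \<Rightarrow> 'a"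
    using that by (simp add: o_assoc)
  define u where "u \<sigma> = f \<sigma> + f (d1 \<circ> \<sigma>) + f (d2 \<circ> \<sigma>) + f (d3 \<circ> \<sigma>)" for \<sigma>
  have u: "u (d1 \<circ> \<sigma>) = u \<sigma>" "u (d2 \<circ> \<sigma>) = u \<sigma>" "u (d3 \<circ> \<sigma>) = u \<sigma>" for \<sigma>
    unfolding u_def dd[THEN dd'] by simp_all
  have ur: "u (r \<circ> (d1 \<circ> \<sigma>)) = u (r \<circ> \<sigma>)" "u (r \<circ> (d2 \<circ> \<sigma>)) = u (r \<circ> \<sigma>)"
    "u (r \<circ> (d3 \<circ> \<sigma>)) = u (r \<circ> \<sigma>)" for \<sigma>
    using rd u[of "r \<circ> \<sigma>"] by (metis o_assoc)+
  \<comment> \<open>\<open>u\<close> sums \<open>f\<close> over the orbits of the four-group, so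
    pairing it with an invariant function gives four equal terms. This applies to \<open>u\<close>
    itself and, by normality, to its translate by \<open>r\<close>.\<close>
  have proj: "(\<Sum>\<sigma> | \<sigma> permutes V. u \<sigma> * h \<sigma>) = 4 * (\<Sum>\<sigma> | \<sigma> permutes V. f \<sigma> * h \<sigma>)"
    if h: "\<And>\<sigma>. h (d1 \<circ> \<sigma>) = h \<sigma>" "\<And>\<sigma>. h (d2 \<circ> \<sigma>) = h \<sigma>" "\<And>\<sigma>. h (d3 \<circ> \<sigma>) = h \<sigma>" for h
  proof -
    have "(\<Sum>\<sigma> | \<sigma> permutes V. f (d \<circ> \<sigma>) * h \<sigma>) = (\<Sum>\<sigma> | \<sigma> permutes V. f \<sigma> * h \<sigma>)"
      if "d permutes V" "\<And>\<sigma>. h (d \<circ> \<sigma>) = h \<sigma>" for d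
      using sum_permutes_shift[OF that(1), of "\<lambda>\<sigma>. f \<sigma> * h \<sigma>"] that(2) by simp
    from this[OF perm(1) h(1)] this[OF perm(2) h(2)] this[OF perm(3) h(3)] show ?thesis
      unfolding u_def by (simp add: distrib_right sum.distrib)
  qed
  let ?uu = "\<Sum>\<sigma> | \<sigma> permutes V. u \<sigma> * u \<sigma>" and ?ur = "\<Sum>\<sigma> | \<sigma> permutes V. u \<sigma> * u (r \<circ> \<sigma>)"
  have nonneg: "0 \<le> (\<Sum>\<sigma> | \<sigma> permutes V. (u \<sigma> - u (r \<circ> \<sigma>))\<^sup>2)"
    by (intro sum_nonneg) auto
  have square: "(\<Sum>\<sigma> | \<sigma> permutes V. (u \<sigma> - u (r \<circ> \<sigma>))\<^sup>2) =
      ?uu + (\<Sum>\<sigma> | \<sigma> permutes V. u (r \<circ> \<sigma>) * u (r \<circ> \<sigma>)) - 2 * ?ur"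
    by (simp add: sum_distrib_left sum.distrib sum_subtractf power2_eq_square algebra_simps)
  have "(\<Sum>\<sigma> | \<sigma> permutes V. u (r \<circ> \<sigma>) * u (r \<circ> \<sigma>)) = ?uu"
    by (rule sum_permutes_shift[OF perm(4)])
  with nonneg square have "?ur \<le> ?uu" by linarith
  moreover have "?uu = 4 * (\<Sum>\<sigma> | \<sigma> permutes V. f \<sigma> * u \<sigma>)"
    by (rule proj) (simp_all add: u)
  moreover have "?ur = 4 * (\<Sum>\<sigma> | \<sigma> permutes V. f \<sigma> * u (r \<circ> \<sigma>))"
    by (rule proj) (simp_all add: ur)
  moreover have "(\<Sum>\<sigma> | \<sigma> permutes V. f \<sigma> * u \<sigma>) = \<phi> id + \<phi> d1 + \<phi> d2 + \<phi> d3"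
    unfolding u_def \<phi>_def by (simp add: distrib_left sum.distrib)
  moreover have "(\<Sum>\<sigma> | \<sigma> permutes V. f \<sigma> * u (r \<circ> \<sigma>)) = \<phi> r + \<phi> (d1 \<circ> r) + \<phi> (d2 \<circ> r) + \<phi> (d3 \<circ> r)"
    unfolding u_def \<phi>_def by (simp add: distrib_left sum.distrib o_assoc)
  moreover have "\<phi> d1 = q v x z w" "\<phi> d2 = q v z x w" "\<phi> d3 = q v w x z"
    unfolding d q_def by simp_all
  moreover have "\<phi> r = q v x v z" unfolding r
    using three_cycle(1)[of v x z] V ne by (simp add: q_def)
  moreover have "\<phi> (d1 \<circ> r) = q x z x w" unfolding dr
    using three_cycle(4)[of x z w] V ne by (simp add: q_def)
  moreover have "\<phi> (d2 \<circ> r) = q v x v w" unfolding dr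
    using three_cycle(4)[of v x w] V ne by (simp add: q_def)
  moreover have "\<phi> (d3 \<circ> r) = q v z v w" unfolding dr
    using three_cycle(1)[of v z w] V ne by (simp add: q_def)
  ultimately show ?thesis by linarith
qed

text \<open>The group algebra element \<open>1 + (x y) - (v x) - (v y)\<close> applied to
  \<open>f\<close>. Summed with weights \<open>d x * d y\<close>, its quadratic form is exactly the
  difference of the two sides of the octopus inequality.\<close>

definition t :: "'a \<Rightarrow> 'a \<Rightarrow> 'a \<Rightarrow> ('a \<Rightarrow> 'a) \<Rightarrow> real" where
  "t v x y \<sigma> = f \<sigma> + f (Transposition.transpose x y \<circ> \<sigma>)
     - f (Transposition.transpose v x \<circ> \<sigma>) - f (Transposition.transpose v y \<circ> \<sigma>)"

definition M :: "'a \<Rightarrow> 'a \<Rightarrow> 'a \<Rightarrow> real" where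
  "M v x y = (\<Sum>\<sigma> | \<sigma> permutes V. f \<sigma> * t v x y \<sigma>)"

definition G :: "'a \<Rightarrow> 'a \<Rightarrow> 'a \<Rightarrow> 'a \<Rightarrow> 'a \<Rightarrow> real" where
  "G v x y z w = (\<Sum>\<sigma> | \<sigma> permutes V. t v x y \<sigma> * t v z w \<sigma>)"

lemma M_eq: "M v x y = \<phi> id + p x y - p v x - p v y"
  unfolding M_def t_def \<phi>_def p_def
  by (simp add: algebra_simps sum.distrib sum_subtractf)

lemma G_eq:
  assumes "v \<in> V" "x \<in> V" "y \<in> V" "z \<in> V" "w \<in> V"
  shows "G v x y z w = \<phi> id + p z w - p v z - p v w
    + (p x y + q x y z w - q x y v z - q x y v w)
    - (p v x + q v x z w - q v x v z - q v x v w)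
    - (p v y + q v y z w - q v y v z - q v y v w)"
proof -
  have "(\<Sum>\<sigma> | \<sigma> permutes V. f \<sigma> * f \<sigma>) = \<phi> id" by (simp add: \<phi>_def)
  then show ?thesis
    unfolding G_def t_def using assms
    by (simp add: ring_distribs sum.distrib sum_subtractf sum_p sum_q q_sym)
qed

lemma t_commute: "t v x y = t v y x"
  unfolding t_def by (auto simp: transpose_commute fun_eq_iff)

lemma M_commute: "M v x y = M v y x"
  unfolding M_def by (simp add: t_commute)

lemma G_commute: "G v x y z w = G v y x z w" "G v x y z w = G v x y w z" "G v x y z w = G v z w x y"
  unfolding G_def by (simp_all only: t_commute[of v x y] t_commute[of v z w]) (simp add: mult.commute)

text \<open>Contribution of one quadruple of legs to \<open>2 a T - T^2\<close>, where
  \<open>T\<close> is the weighted sum of the \<open>t v x y\<close> and \<open>a\<close> that of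
  the factors \<open>1 + of_bool (x = y)\<close>. These factors are calibrated by a single leg:
  \<open>t v x x\<close> is the element \<open>2 - 2 (v x)\<close>, whose square is four times
  itself, and 4 = 2 + 2.\<close>

definition H :: "'a \<Rightarrow> 'a \<Rightarrow> 'a \<Rightarrow> 'a \<Rightarrow> 'a \<Rightarrow> real" where
  "H v x y z w = (1 + of_bool (x = y)) * M v z w + (1 + of_bool (z = w)) * M v x y - G v x y z w"

lemma H_commute: "H v x y z w = H v y x z w" "H v x y z w = H v x y w z" "H v x y z w = H v z w x y"
proof -
  show "H v x y z w = H v y x z w"
    unfolding H_def by (simp add: G_commute(1)[of v x y z w] M_commute[of v x y] eq_commute[of x y])
  show "H v x y z w = H v x y w z"
    unfolding H_def by (simp add: G_commute(2)[of v x y z w] M_commute[of v z w] eq_commute[of z w])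
  show "H v x y z w = H v z w x y"
    unfolding H_def by (simp add: G_commute(3)[of v x y z w])
qed

text \<open>For three different legs the sum is twice the expression bounded by means of the
  four-group. If the legs coincide further, all terms cancel and the sum is 0.\<close>

lemma coincident_pairings_nonneg:
  assumes V: "v \<in> V" "x \<in> V" "z \<in> V" "w \<in> V" and ne: "x \<noteq> v" "z \<noteq> v" "w \<noteq> v"
  shows "0 \<le> H v x x z w + 2 * H v x z x w"
proof -
  have ne': "v \<noteq> x" "v \<noteq> z" "v \<noteq> w" using ne by auto
  consider "z = x" "w = x" | "z = x" "w \<noteq> x" | "z \<noteq> x" "w = x" | "z = w" "w \<noteq> x" 
    | "z \<noteq> x" "w \<noteq> x" "z \<noteq> w" by blast
  then show ?thesis
  proof cases
    case 1
    then show ?thesis using V by (simp add: H_def M_eq G_eq q_sym)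
  next
    case 2
    then show ?thesis using V ne' three_cycle[of v x w]
      by (simp add: H_def M_eq G_eq)
  next
    case 3
    then show ?thesis using V ne' three_cycle[of v x z] 
      by (simp add: H_def M_eq G_eq p_commute[of z x] q_commute(1)[of z x] q_commute(2)[of _ _ z x])
  next
    case 4
    then show ?thesis using V ne' three_cycle[of v x z]
      by (simp add: H_def M_eq G_eq)
  next
    case 5
    have "H v x x z w + 2 * H v x z x w = 2 * (\<phi> id + q v x z w + q v z x w + q v w x z
      - (q v x v z + q v x v w + q v z v w + q x z x w))"
      using V ne' 5 three_cycle[of v x z] three_cycle[of v x w] three_cycle[of v z w] three_cycle[of x z w]
        q_sym[of v x z w] q_sym[of v z x w] q_sym[of v w x z]
      by (simp add: H_def M_eq G_eq)
    then show ?thesis using klein_four_bound[of v x z w] V ne' 5 by simp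
  qed
qed

text \<open>This is where the bound on the legs enters: among four indices two agree, so one pairing
  joins the equal indices and the other two pairings have the same value by symmetry.\<close>

lemma pairings_nonneg:
  assumes v: "v \<in> V" and W: "W \<subseteq> V - {v}" "card W \<le> 3" "finite W"
    and V: "x \<in> W" "y \<in> W" "z \<in> W" "w \<in> W"
  shows "0 \<le> H v x y z w + H v x z y w + H v x w y z"
proof -
  have bound: "0 \<le> H v a a b c + 2 * H v a b a c" if "a \<in> W" "b \<in> W" "c \<in> W" for a b c
    using coincident_pairings_nonneg[of v a b c] that W v by auto
  have "card {x, y, z, w} \<le> 3"
    using card_mono[OF W(3), of "{x, y, z, w}"] V W(2) by auto
  then consider "x = y" | "x = z" | "x = w" | "y = z" | "y = w" | "z = w"
    by (cases "distinct [x, y, z, w]") (auto simp: card_insert_if)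
  then show ?thesis
  proof cases
    case 1
    with bound[of x z w] V H_commute[of v x w x z] H_commute(1)[of v w x x z] H_commute(3)[of v x w x z]
    show ?thesis by simp
  next
    case 2
    with bound[of x y w] V H_commute[of v x w y x] H_commute[of v x y x w] H_commute(2)[of v x w x y]
    show ?thesis by simp
  next
    case 3
    with bound[of x y z] V H_commute(2)[of v x y z x] H_commute(2)[of v x z y x]  H_commute(3)[of v x y x z]
    show ?thesis by simp
  next
    case 4
    with bound[of y x w] V H_commute(1)[of v y x y w] H_commute(3)[of v y y x w]
    show ?thesis by (simp add: H_commute(3)[of v x w y y])
  next
    case 5
    with bound[of y x z] V H_commute(1)[of v y x y z] H_commute(2)[of v x y z y] H_commute(3)[of v y y x z]
    show ?thesis by simp
  next
    case 6
    with bound[of z x y] V H_commute(1)[of v z x z y] H_commute(3)[of v z z x y] H_commute(2)[of v x z y z]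
    show ?thesis by simp
  qed
qed

end

section \<open>Fourfold sums and averaging over pairings\<close>

definition sum4 :: "'a set \<Rightarrow> ('a \<Rightarrow> real) \<Rightarrow> ('a \<Rightarrow> 'a \<Rightarrow> 'a \<Rightarrow> 'a \<Rightarrow> real) \<Rightarrow> real" where
  "sum4 W d F = (\<Sum>x\<in>W. \<Sum>y\<in>W. \<Sum>z\<in>W. \<Sum>w\<in>W. d x * d y * d z * d w * F x y z w)"

lemma sum4_swap:
  "sum4 W d (\<lambda>x y z w. F x z y w) = sum4 W d F"
  "sum4 W d (\<lambda>x y z w. F x y w z) = sum4 W d F"
proof -
  have "sum4 W d (\<lambda>x y z w. F x z y w) =
     (\<Sum>x\<in>W. \<Sum>z\<in>W. \<Sum>y\<in>W. \<Sum>w\<in>W. d x * d y * d z * d w * F x z y w)"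
    unfolding sum4_def by (intro sum.cong refl sum.swap)
  then show "sum4 W d (\<lambda>x y z w. F x z y w) = sum4 W d F"
    unfolding sum4_def by (simp add: ac_simps)
  have "sum4 W d (\<lambda>x y z w. F x y w z) =
     (\<Sum>x\<in>W. \<Sum>y\<in>W. \<Sum>w\<in>W. \<Sum>z\<in>W. d x * d y * d z * d w * F x y w z)"
    unfolding sum4_def by (intro sum.cong refl sum.swap)
  then show "sum4 W d (\<lambda>x y z w. F x y w z) = sum4 W d F"
    unfolding sum4_def by (simp add: ac_simps)
qed

lemma sum4_add: "sum4 W d (\<lambda>x y z w. F x y z w + F' x y z w) = sum4 W d F + sum4 W d F'"
  unfolding sum4_def by (simp add: distrib_left sum.distrib)

lemma sum4_diff: "sum4 W d (\<lambda>x y z w. F x y z w - F' x y z w) = sum4 W d F - sum4 W d F'"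
  unfolding sum4_def by (simp add: right_diff_distrib sum_subtractf)

lemma sum4_prod: "sum4 W d (\<lambda>x y z w. F x y * F' z w) =
  (\<Sum>x\<in>W. \<Sum>y\<in>W. d x * d y * F x y) * (\<Sum>z\<in>W. \<Sum>w\<in>W. d z * d w * F' z w)"
  unfolding sum4_def sum_distrib_right unfolding sum_distrib_left by (simp add: ac_simps)

text \<open>The product weight is symmetric, so three times \<open>sum4 W d F\<close> equals the sum
  over the three pairings. Averaging is essential because \<open>H\<close> can be negative at a
  single quadruple.\<close>

lemma sum4_nonneg_of_pairings:
  assumes d: "\<And>x. x \<in> W \<Longrightarrow> 0 \<le> d x"
    and F: "\<And>x y z w. x \<in> W \<Longrightarrow> y \<in> W \<Longrightarrow> z \<in> W \<Longrightarrow> w \<in> W \<Longrightarrow>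
      0 \<le> F x y z w + F x z y w + F x w y z"
  shows "0 \<le> sum4 W d F"
proof -
  have "0 \<le> sum4 W d (\<lambda>x y z w. F x y z w + F x z y w + F x w y z)"
    unfolding sum4_def using d F by (intro sum_nonneg mult_nonneg_nonneg) auto
  also have "\<dots> = sum4 W d F + sum4 W d (\<lambda>x y z w. F x z y w) + sum4 W d (\<lambda>x y z w. F x w y z)"
    by (simp add: sum4_add)
  also have "sum4 W d (\<lambda>x y z w. F x w y z) = sum4 W d (\<lambda>x y z w. F x z y w)"
    by (rule sum4_swap(2))
  finally show ?thesis by (simp add: sum4_swap(1)[of W d F])
qed

text \<open>
  With \<open>T = \<Sum> d\<^sub>x d\<^sub>y t\<^sub>x\<^sub>y\<close> and \<open>a = \<Sum> d\<^sub>x d\<^sub>y (1 + [x = y])\<close> the operator inequality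
  \<open>T\<^sup>2 \<le> 2 a T\<close> holds, so \<open>T\<close> is positive semidefinite.
\<close>

lemma (in permutation_function) octopus_three_legs:
  assumes v: "v \<in> V" and W: "W \<subseteq> V - {v}" "card W \<le> 3" "finite W"
    and d: "\<And>x. x \<in> W \<Longrightarrow> 0 \<le> d x"
  shows "(\<Sum>x\<in>W. \<Sum>y\<in>W. d x * d y * (\<phi> id - p x y)) \<le>
    2 * (\<Sum>x\<in>W. d x) * (\<Sum>x\<in>W. d x * (\<phi> id - p v x))"
proof -
  define Q where "Q = (\<Sum>x\<in>W. \<Sum>y\<in>W. d x * d y * M v x y)"
  define a where "a = (\<Sum>x\<in>W. \<Sum>y\<in>W. d x * d y * (1 + of_bool (x = y)))"
  have a: "a = (\<Sum>x\<in>W. d x)\<^sup>2 + (\<Sum>x\<in>W. (d x)\<^sup>2)"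
  proof -
    have "(\<Sum>y\<in>W. d x * d y * of_bool (x = y)) = (d x)\<^sup>2" if "x \<in> W" for x
      using that W(3) by (subst sum.remove[of _ x]) (auto simp: power2_eq_square intro!: sum.neutral)
    then show ?thesis
      unfolding a_def by (simp add: distrib_left sum.distrib sum_product power2_eq_square)
  qed
  have "0 \<le> sum4 W d (H v)"
    by (rule sum4_nonneg_of_pairings) (use d pairings_nonneg[OF v W] in auto)
  also have "sum4 W d (H v) = a * Q + Q * a - sum4 W d (G v)"
  proof -
    have "sum4 W d (H v) = sum4 W d (\<lambda>x y z w. (1 + of_bool (x = y)) * M v z w)
       + sum4 W d (\<lambda>x y z w. M v x y * (1 + of_bool (z = w))) - sum4 W d (G v)"
      unfolding sum4_add[symmetric] sum4_diff[symmetric] H_def[abs_def] by (simp add: ac_simps)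
    then show ?thesis unfolding sum4_prod a_def Q_def by simp
  qed
  finally have "sum4 W d (G v) \<le> 2 * (a * Q)" by (simp add: mult.commute)
  moreover have "sum4 W d (G v) = (\<Sum>\<sigma> | \<sigma> permutes V. sum4 W d (\<lambda>x y z w. t v x y \<sigma> * t v z w \<sigma>))"
    unfolding sum4_def G_def sum_distrib_left
    by (simp only: sum.swap[of _ W "{\<sigma>. \<sigma> permutes V}"])
  \<comment> \<open>For fixed \<sigma> the fourfold sum factors as a square, the value of
    \<open>T f\<close> squared.\<close>
  moreover have "\<dots> \<ge> 0"
    unfolding sum4_prod by (intro sum_nonneg) auto
  ultimately have aQ: "0 \<le> a * Q" by simp
  \<comment> \<open>One may divide by \<open>a\<close> unless all legs have weight 0, and then
    \<open>Q\<close> is 0 anyway.\<close>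
  have "0 \<le> Q"
  proof (cases "a = 0")
    case True
    then have "(\<Sum>x\<in>W. (d x)\<^sup>2) = 0" unfolding a
      by (smt (verit) sum_nonneg zero_le_power2)
    then have "\<forall>x\<in>W. d x = 0" using W(3) by (simp add: sum_nonneg_eq_0_iff)
    then show ?thesis unfolding Q_def by simp
  next
    case False
    then have "a > 0" unfolding a by (smt (verit) sum_nonneg zero_le_power2)
    with aQ show ?thesis by (simp add: zero_le_mult_iff)
  qed
  also have "Q = 2 * (\<Sum>x\<in>W. d x) * (\<Sum>x\<in>W. d x * (\<phi> id - p v x)) -
    (\<Sum>x\<in>W. \<Sum>y\<in>W. d x * d y * (\<phi> id - p x y))"
  proof -
    have "(\<Sum>x\<in>W. d x) * (\<Sum>y\<in>W. d y * (\<phi> id - p v y)) = (\<Sum>x\<in>W. \<Sum>y\<in>W. d x * d y * (\<phi> id - p v y))"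
      by (simp add: sum_product mult.assoc)
    moreover have "(\<Sum>x\<in>W. d x * (\<phi> id - p v x)) * (\<Sum>y\<in>W. d y) = (\<Sum>x\<in>W. \<Sum>y\<in>W. d x * d y * (\<phi> id - p v x))"
      unfolding sum_product by (simp add: ac_simps)
    moreover have "Q = (\<Sum>x\<in>W. \<Sum>y\<in>W. d x * d y * (\<phi> id - p v x) + d x * d y * (\<phi> id - p v y)
        - d x * d y * (\<phi> id - p x y))"
      unfolding Q_def M_eq by (intro sum.cong refl) (simp add: algebra_simps)
    ultimately show ?thesis
      by (simp only: sum.distrib sum_subtractf) (simp only: mult.commute mult_2 distrib_left)
  qed
  finally show ?thesis by simp
qed

section \<open>Dirichlet forms and reduction of a vertex\<close>

definition rw_form :: "'a set \<Rightarrow> ('a \<Rightarrow> 'a \<Rightarrow> real) \<Rightarrow> ('a \<Rightarrow> real) \<Rightarrow> ('a \<Rightarrow> real) \<Rightarrow> real" where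
  "rw_form V c g h = (\<Sum>x\<in>V. \<Sum>y\<in>V. c x y * ((g x - g y) * (h x - h y))) / 2"

text \<open>The inner product of \<open>f\<close> with the generator applied to \<open>h\<close>;
  halving compensates for counting each edge in both orders. A permutation maps labels to positions,
  so composition on the left exchanges the labels at two positions.\<close>

definition ip_form :: "'a set \<Rightarrow> ('a \<Rightarrow> 'a \<Rightarrow> real) \<Rightarrow> (('a \<Rightarrow> 'a) \<Rightarrow> real) \<Rightarrow> (('a \<Rightarrow> 'a) \<Rightarrow> real) \<Rightarrow> real" where
  "ip_form V c f h = (\<Sum>x\<in>V. \<Sum>y\<in>V. c x y *
     (\<Sum>\<sigma> | \<sigma> permutes V. f \<sigma> * (h \<sigma> - h (Transposition.transpose x y \<circ> \<sigma>)))) / 2"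

definition marginal :: "'a set \<Rightarrow> (('a \<Rightarrow> 'a) \<Rightarrow> real) \<Rightarrow> 'a \<Rightarrow> 'a \<Rightarrow> real" where
  "marginal V f l x = (\<Sum>\<sigma> | \<sigma> permutes V \<and> \<sigma> l = x. f \<sigma>)"

section \<open>Sums over permutations grouped by the position of a label\<close>

lemma sum_permutes_fiber:
  assumes "l \<in> V" "x \<in> V"
  shows "(\<Sum>\<sigma> | \<sigma> permutes V \<and> \<sigma> l = x. F \<sigma>) =
    (\<Sum>\<rho> | \<rho> permutes (V - {x}). F (\<rho> \<circ> Transposition.transpose l x))"
proof (rule sum.reindex_bij_witness[where j = "\<lambda>\<sigma>. \<sigma> \<circ> Transposition.transpose l x"
      and i = "\<lambda>\<rho>. \<rho> \<circ> Transposition.transpose l x"])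
  note tr = permutes_swap_id[OF assms]
  fix \<sigma> assume "\<sigma> \<in> {\<sigma>. \<sigma> permutes V \<and> \<sigma> l = x}"
  then have \<sigma>: "\<sigma> permutes V" "\<sigma> l = x" by auto
  have "\<sigma> \<circ> Transposition.transpose l x permutes (V - {x})"
    by (rule permutes_superset[OF permutes_compose[OF tr \<sigma>(1)]]) (use \<sigma>(2) in auto)
  then show "\<sigma> \<circ> Transposition.transpose l x \<in> {\<rho>. \<rho> permutes (V - {x})}" by simp
next
  note tr = permutes_swap_id[OF assms]
  fix \<rho> assume "\<rho> \<in> {\<rho>. \<rho> permutes (V - {x})}"
  then have \<rho>: "\<rho> permutes (V - {x})" by auto
  have "\<rho> permutes V" by (rule permutes_subset[OF \<rho>]) auto
  from permutes_compose[OF tr this] permutes_not_in[OF \<rho>, of x]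
  show "\<rho> \<circ> Transposition.transpose l x \<in> {\<sigma>. \<sigma> permutes V \<and> \<sigma> l = x}" by auto
qed (auto simp: comp_assoc)

lemma sum_by_value:
  assumes "finite V" "l \<in> V"
  shows "(\<Sum>x\<in>V. \<Sum>\<sigma> | \<sigma> permutes V \<and> \<sigma> l = x. F \<sigma>) = (\<Sum>\<sigma> | \<sigma> permutes V. F \<sigma>)"
proof -
  have "(\<lambda>\<sigma>. \<sigma> l) ` {\<sigma>. \<sigma> permutes V} \<subseteq> V"
    using assms(2) by (auto simp: permutes_in_image)
  from sum.group[OF finite_permutations[OF assms(1)] assms(1) this, of F] show ?thesis by simp
qed

lemma sum_by_argument:
  assumes "finite V" "x \<in> V"
  shows "(\<Sum>l\<in>V. \<Sum>\<sigma> | \<sigma> permutes V \<and> \<sigma> l = x. F \<sigma>) = (\<Sum>\<sigma> | \<sigma> permutes V. F \<sigma>)"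
proof -
  have "(\<lambda>\<sigma>. inv_into UNIV \<sigma> x) ` {\<sigma>. \<sigma> permutes V} \<subseteq> V"
    using assms(2) by (auto simp: permutes_in_image[OF permutes_inv])
  moreover have "{\<sigma>. \<sigma> permutes V \<and> \<sigma> l = x} = {\<sigma> \<in> {\<sigma>. \<sigma> permutes V}. inv_into UNIV \<sigma> x = l}" for l
    by (auto simp: permutes_inv_eq permutes_inverses)
  ultimately show ?thesis
    using sum.group[OF finite_permutations[OF assms(1)] assms(1), of "\<lambda>\<sigma>. inv_into UNIV \<sigma> x" F] by simp
qed

lemma sum_times_label:
  assumes "finite V" "l \<in> V"
  shows "(\<Sum>\<sigma> | \<sigma> permutes V. f \<sigma> * G (\<sigma> l)) = (\<Sum>x\<in>V. marginal V f l x * G x)"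
proof -
  have "(\<Sum>x\<in>V. marginal V f l x * G x) = (\<Sum>x\<in>V. \<Sum>\<sigma> | \<sigma> permutes V \<and> \<sigma> l = x. f \<sigma> * G (\<sigma> l))"
    unfolding marginal_def sum_distrib_right by (intro sum.cong refl) auto
  then show ?thesis using sum_by_value[OF assms, of "\<lambda>\<sigma>. f \<sigma> * G (\<sigma> l)"] by simp
qed

lemma sum_label_permutes:
  assumes "finite V" "l \<in> V"
  shows "(\<Sum>\<sigma> | \<sigma> permutes V. G (\<sigma> l)) = fact (card V - 1) * (\<Sum>x\<in>V. G x :: real)"
proof -
  have "marginal V (\<lambda>_. 1) l x = fact (card V - 1)" if "x \<in> V" for x
    unfolding marginal_def sum_permutes_fiber[OF assms(2) that]
    using assms(1) that by (simp add: card_permutations)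
  then show ?thesis
    using sum_times_label[OF assms, of "\<lambda>_. 1" G] by (simp add: sum_distrib_left)
qed

text \<open>Given that label \<open>l\<close> sits at \<open>x\<close>, another label is uniform on
  the remaining positions, where \<open>G\<close> adds up to \<open>- G x\<close>; each of its
  positions leaves (card V - 2)! arrangements.\<close>

lemma marginal_label:
  assumes V: "finite V" "l \<in> V" "m \<in> V" "x \<in> V" and G: "(\<Sum>x\<in>V. G x) = 0"
  shows "marginal V (\<lambda>\<sigma>. G (\<sigma> m)) l x = (if m = l then fact (card V - 1) else - fact (card V - 2)) * G x"
proof (cases "m = l")
  case True
  have "marginal V (\<lambda>\<sigma>. G (\<sigma> l)) l x = marginal V (\<lambda>_. 1) l x * G x"
    unfolding marginal_def sum_distrib_right by (intro sum.cong refl) auto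
  also have "marginal V (\<lambda>_. 1) l x = fact (card V - 1)"
    unfolding marginal_def sum_permutes_fiber[OF V(2,4)]
    using V by (simp add: card_permutations)
  finally show ?thesis using True by simp
next
  case False
  define k where "k = Transposition.transpose l x m"
  have k: "k \<in> V - {x}" using False V unfolding k_def Transposition.transpose_def by auto
  have "marginal V (\<lambda>\<sigma>. G (\<sigma> m)) l x = (\<Sum>\<rho> | \<rho> permutes (V - {x}). G (\<rho> k))"
    unfolding marginal_def sum_permutes_fiber[OF V(2,4)] k_def by simp
  also have "\<dots> = fact (card (V - {x}) - 1) * (\<Sum>y\<in>V - {x}. G y)"
    by (rule sum_label_permutes) (use V k in auto)
  also have "(\<Sum>y\<in>V - {x}. G y) = - G x"
    using V G by (simp add: sum_diff1)
  also have "card (V - {x}) - 1 = card V - 2" using V by simp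
  finally show ?thesis using False by simp
qed

text \<open>A swap of \<open>x\<close> and \<open>y\<close> moves the label only if it sits at one
  of them, so a function of its position evolves as under the random walk, and \<open>f\<close>
  enters only through its marginal.\<close>

lemma ip_form_label:
  assumes V: "finite V" "l \<in> V"
  shows "ip_form V c f (\<lambda>\<sigma>. G (\<sigma> l)) = rw_form V c (marginal V f l) G"
proof -
  have "(\<Sum>\<sigma> | \<sigma> permutes V. f \<sigma> * (G (\<sigma> l) - G ((Transposition.transpose x y \<circ> \<sigma>) l))) =
    (marginal V f l x - marginal V f l y) * (G x - G y)" if "x \<in> V" "y \<in> V" for x y
  proof -
    have "(\<Sum>\<sigma> | \<sigma> permutes V. f \<sigma> * (G (\<sigma> l) - G ((Transposition.transpose x y \<circ> \<sigma>) l))) =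
      (\<Sum>z\<in>V. marginal V f l z * (G z - G (Transposition.transpose x y z)))"
      using sum_times_label[OF V, of f "\<lambda>z. G z - G (Transposition.transpose x y z)"] by simp
    also have "\<dots> = (\<Sum>z\<in>{x, y}. marginal V f l z * (G z - G (Transposition.transpose x y z)))"
      by (rule sum.mono_neutral_right) (use that V in auto)
    also have "\<dots> = (marginal V f l x - marginal V f l y) * (G x - G y)"
      by (cases "x = y") (auto simp: algebra_simps)
    finally show ?thesis .
  qed
  then show ?thesis unfolding ip_form_def rw_form_def by simp
qed

lemma ip_form_commute: "ip_form V c f h = ip_form V c h f"
proof -
  have "(\<Sum>\<sigma> | \<sigma> permutes V. f \<sigma> * h (Transposition.transpose x y \<circ> \<sigma>)) =
    (\<Sum>\<sigma> | \<sigma> permutes V. h \<sigma> * f (Transposition.transpose x y \<circ> \<sigma>))" if "x \<in> V" "y \<in> V" for x y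
    using sum_permutes_shift[OF permutes_swap_id[OF that], of "\<lambda>\<sigma>. f \<sigma> * h (Transposition.transpose x y \<circ> \<sigma>)"]
    by (simp add: o_assoc mult.commute)
  then have "(\<Sum>\<sigma> | \<sigma> permutes V. f \<sigma> * (h \<sigma> - h (Transposition.transpose x y \<circ> \<sigma>))) =
    (\<Sum>\<sigma> | \<sigma> permutes V. h \<sigma> * (f \<sigma> - f (Transposition.transpose x y \<circ> \<sigma>)))" if "x \<in> V" "y \<in> V" for x y
    using that by (simp add: right_diff_distrib sum_subtractf mult.commute)
  then show ?thesis unfolding ip_form_def by simp
qed

lemma ip_form_add_right: "ip_form V c f (\<lambda>\<sigma>. h \<sigma> + h' \<sigma>) = ip_form V c f h + ip_form V c f h'"
proof -
  have "f \<sigma> * (h \<sigma> + h' \<sigma> - (h \<tau> + h' \<tau>)) = f \<sigma> * (h \<sigma> - h \<tau>) + f \<sigma> * (h' \<sigma> - h' \<tau>)" for \<sigma> \<tau>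
    by (simp add: algebra_simps)
  then show ?thesis unfolding ip_form_def
    by (simp add: sum.distrib distrib_left add_divide_distrib)
qed

lemma ip_form_scale_right: "ip_form V c f (\<lambda>\<sigma>. a * h \<sigma>) = a * ip_form V c f h"
proof -
  have "f \<sigma> * (a * h \<sigma> - a * h \<tau>) = a * (f \<sigma> * (h \<sigma> - h \<tau>))" for \<sigma> \<tau>
    by (simp add: algebra_simps)
  then show ?thesis unfolding ip_form_def
    by (simp only: sum_distrib_left[symmetric] mult.left_commute[of _ a] times_divide_eq_right)
qed

lemma ip_form_sum_right: "ip_form V c f (\<lambda>\<sigma>. \<Sum>l\<in>L. h l \<sigma>) = (\<Sum>l\<in>L. ip_form V c f (h l))"
proof (induction L rule: infinite_finite_induct)
  case (insert l L)
  then show ?case by (simp add: ip_form_add_right)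
qed (simp_all add: ip_form_def)

text \<open>
  Functions of the position of one label carry the spectrum of the random walk. The function
  \<open>h\<close> in the proof is the orthogonal projection of \<open>f\<close> to their span.
\<close>

lemma ip_bound_by_marginal_free:
  assumes V: "finite V" "2 \<le> card V"
    and rw: "\<And>g. (\<Sum>x\<in>V. g x) = 0 \<Longrightarrow> r * (\<Sum>x\<in>V. (g x)\<^sup>2) \<le> rw_form V c g g"
    and free: "\<And>f. (\<And>l x. l \<in> V \<Longrightarrow> x \<in> V \<Longrightarrow> marginal V f l x = 0) \<Longrightarrow>
      r * (\<Sum>\<sigma> | \<sigma> permutes V. (f \<sigma>)\<^sup>2) \<le> ip_form V c f f"
    and f: "(\<Sum>\<sigma> | \<sigma> permutes V. f \<sigma>) = 0"
  shows "r * (\<Sum>\<sigma> | \<sigma> permutes V. (f \<sigma>)\<^sup>2) \<le> ip_form V c f f"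
proof -
  let ?n = "card V"
  \<comment> \<open>Chosen so that \<open>h\<close> has the same marginals as \<open>f\<close>. With
    n = card V, label \<open>l\<close> contributes (n-1)! times its own marginal, and the others
    contribute -(n-2)! times theirs, which add up to minus that of \<open>l\<close>. The total
    factor is (n-1)! + (n-2)! = n (n-2)!.\<close>
  define \<kappa> where "\<kappa> = 1 / (real ?n * fact (?n - 2))"
  define h where "h \<sigma> = \<kappa> * (\<Sum>l\<in>V. marginal V f l (\<sigma> l))" for \<sigma>
  define k where "k \<sigma> = f \<sigma> - h \<sigma>" for \<sigma>
  have \<kappa>: "\<kappa> \<ge> 0" unfolding \<kappa>_def by simp
  have mean: "(\<Sum>x\<in>V. marginal V f l x) = 0" if "l \<in> V" for l
    using sum_by_value[OF V(1) that, of f] f unfolding marginal_def by simp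
  \<comment> \<open>Exactly one label sits at \<open>x\<close>, so these marginals add up to the
    total of \<open>f\<close>.\<close>
  have mean': "(\<Sum>l\<in>V. marginal V f l x) = 0" if "x \<in> V" for x
    using sum_by_argument[OF V(1) that, of f] f unfolding marginal_def by simp
  have marg_h: "marginal V h l x = marginal V f l x" if "l \<in> V" "x \<in> V" for l x
  proof -
    have "marginal V h l x = \<kappa> * (\<Sum>m\<in>V. marginal V (\<lambda>\<sigma>. marginal V f m (\<sigma> m)) l x)"
      unfolding marginal_def[of V h] marginal_def[of V "\<lambda>\<sigma>. _ \<sigma>"] h_def sum_distrib_left[symmetric]
      by (subst sum.swap) simp
    also have "\<dots> = \<kappa> * (\<Sum>m\<in>V. (if m = l then fact (?n - 1) else - fact (?n - 2)) * marginal V f m x)"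
      using that V mean by (simp add: marginal_label)
    also have "(\<Sum>m\<in>V. (if m = l then fact (?n - 1) else - fact (?n - 2)) * marginal V f m x) =
      fact (?n - 1) * marginal V f l x - fact (?n - 2) * (\<Sum>m\<in>V - {l}. marginal V f m x)"
      using that V(1) by (subst sum.remove[of _ l]) (auto simp: sum_distrib_left sum_negf[symmetric] intro!: sum.cong)
    also have "(\<Sum>m\<in>V - {l}. marginal V f m x) = - marginal V f l x"
      using mean'[OF that(2)] that V(1) by (simp add: sum_diff1)
    also have "(fact (?n - 1) :: real) = (real ?n - 1) * fact (?n - 2)"
      using V(2) fact_reduce[of "?n - 1", where 'a = real] by (simp add: numeral_2_eq_2 of_nat_diff)
    finally have "marginal V h l x = \<kappa> * (real ?n * fact (?n - 2)) * marginal V f l x"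
      by (simp add: algebra_simps)
    then show ?thesis unfolding \<kappa>_def using V(2) by simp
  qed
  have marg_k: "marginal V k l x = 0" if "l \<in> V" "x \<in> V" for l x
    using marg_h[OF that] unfolding marginal_def k_def by (simp add: sum_subtractf)
  have inner_h: "(\<Sum>\<sigma> | \<sigma> permutes V. e \<sigma> * h \<sigma>) = \<kappa> * (\<Sum>l\<in>V. \<Sum>x\<in>V. marginal V e l x * marginal V f l x)" for e
  proof -
    have "(\<Sum>\<sigma> | \<sigma> permutes V. e \<sigma> * h \<sigma>) = \<kappa> * (\<Sum>\<sigma> | \<sigma> permutes V. \<Sum>l\<in>V. e \<sigma> * marginal V f l (\<sigma> l))"
      unfolding h_def by (simp add: sum_distrib_left mult.left_commute)
    also have "\<dots> = \<kappa> * (\<Sum>l\<in>V. \<Sum>\<sigma> | \<sigma> permutes V. e \<sigma> * marginal V f l (\<sigma> l))"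
      by (subst sum.swap) simp
    finally show ?thesis using V by (simp add: sum_times_label)
  qed
  have ip_h: "ip_form V c e h = \<kappa> * (\<Sum>l\<in>V. rw_form V c (marginal V e l) (marginal V f l))" for e
    unfolding h_def[abs_def] ip_form_scale_right ip_form_sum_right using V by (simp add: ip_form_label)
  \<comment> \<open>Inner products and energies against \<open>h\<close> depend only on marginals,
    and those of \<open>k\<close> vanish; so both cross terms are 0.\<close>
  have kh: "(\<Sum>\<sigma> | \<sigma> permutes V. k \<sigma> * h \<sigma>) = 0"
    unfolding inner_h by (simp add: marg_k)
  have ip_kh: "ip_form V c k h = 0"
    unfolding ip_h rw_form_def by (simp add: marg_k)
  have fk: "f = (\<lambda>\<sigma>. k \<sigma> + h \<sigma>)" unfolding k_def by simp
  have "(\<Sum>\<sigma> | \<sigma> permutes V. (f \<sigma>)\<^sup>2) = (\<Sum>\<sigma> | \<sigma> permutes V. (k \<sigma>)\<^sup>2 + 2 * (k \<sigma> * h \<sigma>) + h \<sigma> * h \<sigma>)"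
    unfolding fk by (simp add: power2_eq_square algebra_simps)
  also have "\<dots> = (\<Sum>\<sigma> | \<sigma> permutes V. (k \<sigma>)\<^sup>2) + (\<Sum>\<sigma> | \<sigma> permutes V. h \<sigma> * h \<sigma>)"
    by (simp add: sum.distrib sum_distrib_left[symmetric] kh)
  finally have norm: "(\<Sum>\<sigma> | \<sigma> permutes V. (f \<sigma>)\<^sup>2) =
    (\<Sum>\<sigma> | \<sigma> permutes V. (k \<sigma>)\<^sup>2) + (\<Sum>\<sigma> | \<sigma> permutes V. h \<sigma> * h \<sigma>)" .
  have "ip_form V c f f = ip_form V c f k + ip_form V c f h"
    by (subst (2) fk) (rule ip_form_add_right)
  also have "ip_form V c f k = ip_form V c k k + ip_form V c k h"
    by (subst ip_form_commute, subst fk) (rule ip_form_add_right)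
  also have "ip_form V c f h = ip_form V c h k + ip_form V c h h"
    by (subst ip_form_commute, subst fk) (rule ip_form_add_right)
  finally have form: "ip_form V c f f = ip_form V c k k + ip_form V c h h"
    using ip_kh ip_form_commute[of V c h k] by simp
  have "r * (\<Sum>\<sigma> | \<sigma> permutes V. h \<sigma> * h \<sigma>) = \<kappa> * (\<Sum>l\<in>V. r * (\<Sum>x\<in>V. (marginal V f l x)\<^sup>2))"
    unfolding inner_h by (simp add: marg_h sum_distrib_left[symmetric] power2_eq_square)
  also have "\<dots> \<le> \<kappa> * (\<Sum>l\<in>V. rw_form V c (marginal V f l) (marginal V f l))"
    by (intro mult_left_mono sum_mono rw mean \<kappa>)
  also have "\<dots> = ip_form V c h h"
    unfolding ip_h rw_form_def by (simp add: marg_h)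
  finally show ?thesis
    using free[of k] marg_k unfolding norm form by (simp add: distrib_left)
qed


text \<open>
  If all rates at \<open>v\<close> vanish, the quotient is \<open>0 / 0 = 0\<close> and the rates are unchanged.
\<close>

definition reduced :: "'a \<Rightarrow> 'a set \<Rightarrow> ('a \<Rightarrow> 'a \<Rightarrow> real) \<Rightarrow> 'a \<Rightarrow> 'a \<Rightarrow> real" where
  "reduced v W c x y = c x y + c v x * c v y / (\<Sum>z\<in>W. c v z)"

lemma sum_pairs_remove:
  fixes F :: "'a \<Rightarrow> 'a \<Rightarrow> real"
  assumes "finite V" "v \<in> V" "F v v = 0" "\<And>x. x \<in> V \<Longrightarrow> F x v = F v x"
  shows "(\<Sum>x\<in>V. \<Sum>y\<in>V. F x y) = (\<Sum>x\<in>V - {v}. \<Sum>y\<in>V - {v}. F x y) + 2 * (\<Sum>x\<in>V - {v}. F v x)"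
proof -
  have "(\<Sum>y\<in>V. F x y) = F x v + (\<Sum>y\<in>V - {v}. F x y)" for x
    by (rule sum.remove[OF assms(1,2)])
  then have "(\<Sum>x\<in>V. \<Sum>y\<in>V. F x y) = (\<Sum>x\<in>V. F x v) + (\<Sum>x\<in>V. \<Sum>y\<in>V - {v}. F x y)"
    by (simp add: sum.distrib)
  also have "(\<Sum>x\<in>V. \<Sum>y\<in>V - {v}. F x y) = (\<Sum>y\<in>V - {v}. F v y) + (\<Sum>x\<in>V - {v}. \<Sum>y\<in>V - {v}. F x y)"
    by (rule sum.remove[OF assms(1,2)])
  also have "(\<Sum>x\<in>V. F x v) = (\<Sum>x\<in>V - {v}. F v x)"
    unfolding sum.remove[OF assms(1,2), of "\<lambda>x. F x v"] using assms(3,4) by simp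
  finally show ?thesis by simp
qed

text \<open>
  A function on \<open>V - {v}\<close> is extended to \<open>v\<close> by its weighted average, which makes its energy
  for \<open>c\<close> equal to that for the reduced weights.
\<close>

lemma rw_bound_reduced:
  assumes V: "finite V" "v \<in> V"
    and sym: "\<And>x y. x \<in> V \<Longrightarrow> y \<in> V \<Longrightarrow> c x y = c y x"
    and nonneg: "\<And>x y. x \<in> V \<Longrightarrow> y \<in> V \<Longrightarrow> 0 \<le> c x y"
    and rw: "\<And>g. (\<Sum>x\<in>V. g x) = 0 \<Longrightarrow> r * (\<Sum>x\<in>V. (g x)\<^sup>2) \<le> rw_form V c g g"
    and h: "(\<Sum>x\<in>V - {v}. h x) = 0"
  shows "r * (\<Sum>x\<in>V - {v}. (h x)\<^sup>2) \<le> rw_form (V - {v}) (reduced v (V - {v}) c) h h"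
proof -
  define W where "W = V - {v}"
  define S where "S = (\<Sum>z\<in>W. c v z)"
  define a where "a = (\<Sum>z\<in>W. c v z * h z) / S"
  \<comment> \<open>As \<open>h\<close> has sum 0, its extension by \<open>a\<close> has mean
    \<open>m\<close>. Subtracting it restores mean zero on \<open>V\<close> and leaves the energy
    alone, and the sum of squares stays at least that of \<open>h\<close>.\<close>
  define m where "m = a / real (card V)"
  define g where "g x = (if x = v then a else h x) - m" for x
  have W: "finite W" "v \<notin> W" "V = insert v W" using V unfolding W_def by auto
  have card: "real (card V) > 0" using V card_gt_0_iff by auto
  have S: "S \<ge> 0" unfolding S_def using nonneg V W_def by (intro sum_nonneg) auto
  have S0: "c v x = 0" if "S = 0" "x \<in> W" for x
    using that W nonneg unfolding S_def by (subst (asm) sum_nonneg_eq_0_iff) auto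
  have hW: "(\<Sum>x\<in>W. h x) = 0" using h unfolding W_def .
  have gW: "g x = h x - m" if "x \<in> W" for x using that W unfolding g_def by auto
  have "(\<Sum>x\<in>V. g x) = a - m + (\<Sum>x\<in>W. h x - m)"
    unfolding W(3) using W by (simp add: gW) (simp add: g_def)
  also have "\<dots> = a - real (card V) * m"
    using W hW by (simp add: sum_subtractf algebra_simps)
  also have "\<dots> = 0" unfolding m_def using card by simp
  finally have g0: "(\<Sum>x\<in>V. g x) = 0" .
  have "(\<Sum>x\<in>V. (g x)\<^sup>2) = (a - m)\<^sup>2 + (\<Sum>x\<in>W. (h x - m)\<^sup>2)"
    unfolding W(3) using W by (simp add: gW) (simp add: g_def)
  also have "(\<Sum>x\<in>W. (h x - m)\<^sup>2) = (\<Sum>x\<in>W. (h x)\<^sup>2) - 2 * m * (\<Sum>x\<in>W. h x) + real (card W) * m\<^sup>2"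
  proof -
    have "(\<Sum>x\<in>W. (h x - m)\<^sup>2) = (\<Sum>x\<in>W. (h x)\<^sup>2 - 2 * m * h x + m\<^sup>2)"
      by (intro sum.cong refl) (simp add: power2_diff)
    then show ?thesis by (simp add: sum.distrib sum_subtractf sum_distrib_left)
  qed
  finally have "(\<Sum>x\<in>V. (g x)\<^sup>2) \<ge> (\<Sum>x\<in>W. (h x)\<^sup>2)"
    using hW by simp
  moreover have "rw_form W (reduced v W c) h h = rw_form V c g g"
  proof -
    have "rw_form V c g g = (\<Sum>x\<in>W. \<Sum>y\<in>W. c x y * (g x - g y)\<^sup>2) / 2 + (\<Sum>x\<in>W. c v x * (g v - g x)\<^sup>2)"
      unfolding rw_form_def
      by (subst sum_pairs_remove[OF V]) (use sym V in \<open>auto simp: W_def power2_eq_square algebra_simps add_divide_distrib\<close>)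
    also have "(\<Sum>x\<in>W. c v x * (g v - g x)\<^sup>2) = (\<Sum>x\<in>W. c v x * (a - h x)\<^sup>2)"
      by (intro sum.cong refl) (simp add: gW, simp add: g_def)
    also have "(\<Sum>x\<in>W. \<Sum>y\<in>W. c x y * (g x - g y)\<^sup>2) = (\<Sum>x\<in>W. \<Sum>y\<in>W. c x y * (h x - h y)\<^sup>2)"
      by (simp add: gW)
    \<comment> \<open>Two expressions for \<open>S\<close> times the weighted variance of
      \<open>h\<close>, by distances to the mean and by distances within pairs. Both come to
      \<open>P - R\<^sup>2 / S\<close>.\<close>
    also have "(\<Sum>x\<in>W. c v x * (a - h x)\<^sup>2) =
      (\<Sum>x\<in>W. \<Sum>y\<in>W. c v x * c v y / S * (h x - h y)\<^sup>2) / 2"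
    proof (cases "S = 0")
      case True
      then show ?thesis using S0 by simp
    next
      case False
      define P where "P = (\<Sum>x\<in>W. c v x * (h x)\<^sup>2)"
      define R where "R = (\<Sum>x\<in>W. c v x * h x)"
      have "(\<Sum>x\<in>W. c v x * (a - h x)\<^sup>2) = (\<Sum>x\<in>W. a\<^sup>2 * c v x - 2 * a * (c v x * h x) + c v x * (h x)\<^sup>2)"
        by (intro sum.cong refl) (simp add: power2_eq_square algebra_simps)
      also have "\<dots> = a\<^sup>2 * S - 2 * a * R + P"
        unfolding S_def R_def P_def by (simp add: sum.distrib sum_subtractf sum_distrib_left)
      also have "\<dots> = P - R\<^sup>2 / S"
        using False unfolding a_def R_def[symmetric] by (simp add: power2_eq_square field_simps)
      finally have L: "(\<Sum>x\<in>W. c v x * (a - h x)\<^sup>2) = P - R\<^sup>2 / S" .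
      have "(\<Sum>x\<in>W. \<Sum>y\<in>W. c v x * c v y * (h x - h y)\<^sup>2) =
        (\<Sum>x\<in>W. \<Sum>y\<in>W. c v x * (h x)\<^sup>2 * c v y + c v x * (c v y * (h y)\<^sup>2) - 2 * (c v x * h x * (c v y * h y)))"
        by (intro sum.cong refl) (simp add: power2_eq_square algebra_simps)
      also have "\<dots> = P * S + S * P - 2 * (R * R)"
        unfolding S_def R_def P_def sum_product
        by (simp add: sum.distrib sum_subtractf sum_distrib_left)
      finally have "(\<Sum>x\<in>W. \<Sum>y\<in>W. c v x * c v y / S * (h x - h y)\<^sup>2) = (P * S + S * P - 2 * (R * R)) / S"
        by (simp only: times_divide_eq_left sum_divide_distrib[symmetric])
      then show ?thesis using False unfolding L by (simp add: power2_eq_square field_simps)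
    qed
    also have "(\<Sum>x\<in>W. \<Sum>y\<in>W. c x y * (h x - h y)\<^sup>2) / 2 + (\<Sum>x\<in>W. \<Sum>y\<in>W. c v x * c v y / S * (h x - h y)\<^sup>2) / 2
       = rw_form W (reduced v W c) h h"
      unfolding rw_form_def reduced_def S_def[symmetric]
      by (simp add: distrib_right sum.distrib add_divide_distrib power2_eq_square)
    finally show ?thesis by simp
  qed
  \<comment> \<open>This serves negative \<open>r\<close>, for which the comparison of the sums of
    squares points the wrong way.\<close>
  moreover have "0 \<le> rw_form V c g g"
    unfolding rw_form_def using nonneg
    by (intro divide_nonneg_nonneg sum_nonneg mult_nonneg_nonneg[OF _ zero_le_square]) auto
  ultimately show ?thesis
    unfolding W_def[symmetric] using rw[OF g0]
    by (cases "r \<ge> 0") (smt (verit) mult_left_mono mult_nonpos_nonneg sum_nonneg zero_le_power2)+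
qed

lemma ip_form_eq_autocorrelation:
  "ip_form V c f f = (\<Sum>x\<in>V. \<Sum>y\<in>V. c x y *
     (permutation_function.\<phi> V f id - permutation_function.p V f x y)) / 2"
  unfolding ip_form_def permutation_function.p_def permutation_function.\<phi>_def
  by (simp add: right_diff_distrib sum_subtractf)

text \<open>Swaps away from \<open>v\<close> keep the label at \<open>v\<close>, so their terms
  split exactly over the fibres of permutations with a given label at \<open>v\<close>. The star at
  \<open>v\<close> has no counterpart within a fibre; the octopus inequality trades it for the extra
  rates among the neighbours.\<close>

lemma ip_form_removal:
  assumes V: "finite V" "v \<in> V"
    and sym: "\<And>x y. x \<in> V \<Longrightarrow> y \<in> V \<Longrightarrow> c x y = c y x"
    and nonneg: "\<And>x y. x \<in> V \<Longrightarrow> y \<in> V \<Longrightarrow> 0 \<le> c x y"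
    and legs: "card {x \<in> V - {v}. c v x \<noteq> 0} \<le> 3"
  shows "(\<Sum>l\<in>V. ip_form (V - {v}) (reduced v (V - {v}) c)
      (\<lambda>\<rho>. f (\<rho> \<circ> Transposition.transpose l v)) (\<lambda>\<rho>. f (\<rho> \<circ> Transposition.transpose l v))) \<le> ip_form V c f f"
proof -
  interpret permutation_function V f .
  define U where "U = V - {v}"
  \<comment> \<open>Zero rates are discarded first, since the bound on the number of legs concerns
    nonzero rates only and \<open>U\<close> may be large.\<close>
  define W where "W = {x \<in> U. c v x \<noteq> 0}"
  define S where "S = (\<Sum>z\<in>U. c v z)"
  have U: "finite U" "U \<subseteq> V" using V unfolding U_def by auto
  have W: "finite W" "W \<subseteq> U" "card W \<le> 3" using U legs unfolding W_def U_def by auto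
  have toW: "(\<Sum>x\<in>U. c v x * F x) = (\<Sum>x\<in>W. c v x * F x)" for F :: "'a \<Rightarrow> real"
    by (rule sum.mono_neutral_right) (use U W_def in auto)
  have S: "S = (\<Sum>x\<in>W. c v x)" using toW[of "\<lambda>_. 1"] unfolding S_def by simp
  have S_nonneg: "S \<ge> 0" unfolding S_def using nonneg V U by (intro sum_nonneg) auto
  have "(\<Sum>x\<in>U. \<Sum>y\<in>U. c v x * c v y * (\<phi> id - p x y)) = (\<Sum>x\<in>W. \<Sum>y\<in>W. c v x * c v y * (\<phi> id - p x y))"
    using toW by (simp add: mult.assoc sum_distrib_left[symmetric])
  also have "\<dots> \<le> 2 * S * (\<Sum>x\<in>W. c v x * (\<phi> id - p v x))"
    unfolding S by (rule octopus_three_legs) (use W V U nonneg in \<open>auto simp: U_def\<close>)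
  also have "\<dots> = 2 * S * (\<Sum>x\<in>U. c v x * (\<phi> id - p v x))" by (simp add: toW)
  finally have oct: "(\<Sum>x\<in>U. \<Sum>y\<in>U. c v x * c v y * (\<phi> id - p x y)) \<le> 2 * S * (\<Sum>x\<in>U. c v x * (\<phi> id - p v x))" .
  have "(\<Sum>x\<in>U. \<Sum>y\<in>U. c v x * c v y / S * (\<phi> id - p x y)) \<le> 2 * (\<Sum>x\<in>U. c v x * (\<phi> id - p v x))"
  proof (cases "S = 0")
    case True
    then have "c v x = 0" if "x \<in> U" for x
      using that U nonneg V unfolding S_def by (subst (asm) sum_nonneg_eq_0_iff) auto
    then show ?thesis by simp
  next
    case False
    have "(\<Sum>x\<in>U. \<Sum>y\<in>U. c v x * c v y / S * (\<phi> id - p x y)) =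
      (\<Sum>x\<in>U. \<Sum>y\<in>U. c v x * c v y * (\<phi> id - p x y)) / S"
      by (simp add: sum_divide_distrib)
    also have "\<dots> \<le> 2 * S * (\<Sum>x\<in>U. c v x * (\<phi> id - p v x)) / S"
      by (rule divide_right_mono[OF oct S_nonneg])
    finally show ?thesis using False by simp
  qed
  moreover have "ip_form V c f f = (\<Sum>x\<in>U. \<Sum>y\<in>U. c x y * (\<phi> id - p x y)) / 2 + (\<Sum>x\<in>U. c v x * (\<phi> id - p v x))"
    unfolding ip_form_eq_autocorrelation
    by (subst sum_pairs_remove[OF V]) (use sym V in \<open>auto simp: U_def p_commute add_divide_distrib\<close>)
  moreover have "(\<Sum>l\<in>V. ip_form U (reduced v U c) (\<lambda>\<rho>. f (\<rho> \<circ> Transposition.transpose l v)) (\<lambda>\<rho>. f (\<rho> \<circ> Transposition.transpose l v)))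
    = (\<Sum>x\<in>U. \<Sum>y\<in>U. reduced v U c x y * (\<phi> id - p x y)) / 2"
  proof -
    let ?D = "\<lambda>x y \<sigma>. f \<sigma> * (f \<sigma> - f (Transposition.transpose x y \<circ> \<sigma>))"
    have "(\<Sum>l\<in>V. \<Sum>\<rho> | \<rho> permutes U. ?D x y (\<rho> \<circ> Transposition.transpose l v)) = \<phi> id - p x y" for x y
    proof -
      have "(\<Sum>l\<in>V. \<Sum>\<rho> | \<rho> permutes U. ?D x y (\<rho> \<circ> Transposition.transpose l v)) =
        (\<Sum>l\<in>V. \<Sum>\<sigma> | \<sigma> permutes V \<and> \<sigma> l = v. ?D x y \<sigma>)"
        unfolding U_def using V(2) by (intro sum.cong refl sum_permutes_fiber[symmetric]) auto
      also have "\<dots> = (\<Sum>\<sigma> | \<sigma> permutes V. ?D x y \<sigma>)"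
        by (rule sum_by_argument[OF V])
      also have "\<dots> = \<phi> id - p x y"
        unfolding p_def \<phi>_def by (simp add: right_diff_distrib sum_subtractf)
      finally show ?thesis .
    qed
    note * = this
    show ?thesis
      unfolding ip_form_def sum_divide_distrib[symmetric] *[symmetric] sum_distrib_left[of _ _ V]
      by (simp only: sum.swap[of _ _ V] o_assoc)
  qed
  moreover have "(\<Sum>x\<in>U. \<Sum>y\<in>U. reduced v U c x y * (\<phi> id - p x y)) =
    (\<Sum>x\<in>U. \<Sum>y\<in>U. c x y * (\<phi> id - p x y)) + (\<Sum>x\<in>U. \<Sum>y\<in>U. c v x * c v y / S * (\<phi> id - p x y))"
    unfolding reduced_def S_def[symmetric] by (simp only: distrib_right sum.distrib)
  ultimately show ?thesis unfolding U_def[symmetric] by (simp add: add_divide_distrib)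
qed

text \<open>Ties in rank count as lower, so that whichever vertex of maximal rank is removed, all
  its remaining neighbours belong to this set.\<close>

definition lower_neighbours :: "('a \<Rightarrow> 'a \<Rightarrow> bool) \<Rightarrow> ('a \<Rightarrow> nat) \<Rightarrow> 'a set \<Rightarrow> 'a \<Rightarrow> 'a set" where
  "lower_neighbours E rk V v = {x \<in> V - {v}. E v x \<and> rk x \<le> rk v}"

text \<open>The recursion, with \<open>r\<close>, \<open>E\<close> and \<open>rk\<close> fixed. New
  nonzero rates arise only between neighbours of the removed vertex, hence on pairs already in
  \<open>E\<close>, and deleting a vertex only shrinks the sets of lower neighbours. The restriction
  to \<open>x \<noteq> y\<close> is due to \<open>reduced\<close>, which can create nonzero diagonal
  entries.\<close>

lemma interchange_bound:
  assumes "finite V"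
    and "\<And>x y. x \<in> V \<Longrightarrow> y \<in> V \<Longrightarrow> c x y = c y x"
    and "\<And>x y. x \<in> V \<Longrightarrow> y \<in> V \<Longrightarrow> 0 \<le> c x y"
    and "\<And>x y. x \<in> V \<Longrightarrow> y \<in> V \<Longrightarrow> x \<noteq> y \<Longrightarrow> c x y \<noteq> 0 \<Longrightarrow> E x y"
    and "\<And>v. v \<in> V \<Longrightarrow> card (lower_neighbours E rk V v) \<le> 3"
    and "\<And>v x y. v \<in> V \<Longrightarrow> x \<in> lower_neighbours E rk V v \<Longrightarrow> y \<in> lower_neighbours E rk V v \<Longrightarrow>
      x \<noteq> y \<Longrightarrow> E x y"
    and "\<And>g. (\<Sum>x\<in>V. g x) = 0 \<Longrightarrow> r * (\<Sum>x\<in>V. (g x)\<^sup>2) \<le> rw_form V c g g"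
    and "(\<Sum>\<sigma> | \<sigma> permutes V. f \<sigma>) = 0"
  shows "r * (\<Sum>\<sigma> | \<sigma> permutes V. (f \<sigma>)\<^sup>2) \<le> ip_form V c f f"
  using assms
proof (induction "card V" arbitrary: V c f rule: less_induct)
  case less
  note V = less.prems(1) and sym = less.prems(2) and nonneg = less.prems(3) and edge = less.prems(4)
    and deg = less.prems(5) and clique = less.prems(6) and rw = less.prems(7) and f0 = less.prems(8)
  show ?case
  proof (cases "card V \<le> 1")
    case True
    \<comment> \<open>With at most one vertex there is a single permutation, so mean zero forces
      \<open>f\<close> to vanish at it.\<close>
    then have "card {\<sigma>. \<sigma> permutes V} = 1"
      using card_permutations[OF refl V] by (cases "card V") auto
    then obtain \<tau> where \<tau>: "{\<sigma>. \<sigma> permutes V} = {\<tau>}" using card_1_singletonE by blast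
    then have "f \<tau> = 0" using f0 by simp
    then show ?thesis unfolding ip_form_def \<tau> by simp
  next
    case False
    then have "V \<noteq> {}" by auto
    obtain v where v: "v \<in> V" and max: "\<And>x. x \<in> V \<Longrightarrow> rk x \<le> rk v"
      using obtains_MAX[OF V \<open>V \<noteq> {}\<close>, of rk] by (metis Max_ge V finite_imageI imageI)
    define U where "U = V - {v}"
    have U: "finite U" "U \<subseteq> V" "card U < card V"
      using V v card_Diff1_less[of V v] by (auto simp: U_def)
    have legs: "{x \<in> U. c v x \<noteq> 0} \<subseteq> lower_neighbours E rk V v"
      unfolding lower_neighbours_def U_def using edge v max by auto
    have "finite (lower_neighbours E rk V v)" unfolding lower_neighbours_def using V by auto
    with card_mono[OF this legs] deg[OF v] have legs3: "card {x \<in> U. c v x \<noteq> 0} \<le> 3" by linarith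
    show ?thesis
    proof (rule ip_bound_by_marginal_free[OF V _ rw _ f0])
      show "2 \<le> card V" using False by simp
      fix h :: "('a \<Rightarrow> 'a) \<Rightarrow> real" assume h: "\<And>l x. l \<in> V \<Longrightarrow> x \<in> V \<Longrightarrow> marginal V h l x = 0"
      have IH: "r * (\<Sum>\<rho> | \<rho> permutes U. (h (\<rho> \<circ> Transposition.transpose l v))\<^sup>2) \<le> ip_form U (reduced v U c)
        (\<lambda>\<rho>. h (\<rho> \<circ> Transposition.transpose l v)) (\<lambda>\<rho>. h (\<rho> \<circ> Transposition.transpose l v))" if l: "l \<in> V" for l
      proof (rule less.hyps[OF U(3) U(1)])
        show "reduced v U c x y = reduced v U c y x" if "x \<in> U" "y \<in> U" for x y
          unfolding reduced_def using sym[of x y] that U by (auto simp: mult.commute)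
        show "0 \<le> reduced v U c x y" if "x \<in> U" "y \<in> U" for x y
          unfolding reduced_def using nonneg that U(2) v
          by (intro add_nonneg_nonneg divide_nonneg_nonneg mult_nonneg_nonneg sum_nonneg) auto
        show "E x y" if "x \<in> U" "y \<in> U" "x \<noteq> y" "reduced v U c x y \<noteq> 0" for x y
        proof (cases "c x y = 0")
          case True
          then have "c v x \<noteq> 0" "c v y \<noteq> 0" using that(4) unfolding reduced_def by auto
          then show ?thesis using legs that clique[OF v] by blast
        next
          case False
          then show ?thesis using edge that U by blast
        qed
        show "card (lower_neighbours E rk U u) \<le> 3" if "u \<in> U" for u
        proof -
          have "lower_neighbours E rk U u \<subseteq> lower_neighbours E rk V u"
            unfolding lower_neighbours_def using U by auto
          moreover have "finite (lower_neighbours E rk V u)" unfolding lower_neighbours_def using V by auto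
          ultimately show ?thesis using card_mono deg[of u] that U by (meson le_trans subsetD)
        qed
        show "E x y" if "u \<in> U" "x \<in> lower_neighbours E rk U u" "y \<in> lower_neighbours E rk U u" "x \<noteq> y" for u x y
          using clique[of u x y] that U unfolding lower_neighbours_def by auto
        show "r * (\<Sum>x\<in>U. (g x)\<^sup>2) \<le> rw_form U (reduced v U c) g g" if "(\<Sum>x\<in>U. g x) = 0" for g
          using rw_bound_reduced[OF V v, of c r g] sym nonneg rw that unfolding U_def by blast
        \<comment> \<open>The vanishing marginal of label \<open>l\<close> at \<open>v\<close> is
          precisely the mean-zero condition on this fibre. General functions of mean zero lack it,
          hence the detour through marginal-free ones.\<close>
        show "(\<Sum>\<rho> | \<rho> permutes U. h (\<rho> \<circ> Transposition.transpose l v)) = 0"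
          using h[OF l v] unfolding marginal_def sum_permutes_fiber[OF l v] U_def .
      qed
      have "(\<Sum>\<sigma> | \<sigma> permutes V. (h \<sigma>)\<^sup>2) = (\<Sum>l\<in>V. \<Sum>\<rho> | \<rho> permutes U. (h (\<rho> \<circ> Transposition.transpose l v))\<^sup>2)"
        unfolding sum_by_argument[OF V v, symmetric] U_def
        by (rule sum.cong[OF refl]) (simp add: sum_permutes_fiber v)
      then have "r * (\<Sum>\<sigma> | \<sigma> permutes V. (h \<sigma>)\<^sup>2) =
        (\<Sum>l\<in>V. r * (\<Sum>\<rho> | \<rho> permutes U. (h (\<rho> \<circ> Transposition.transpose l v))\<^sup>2))"
        by (simp add: sum_distrib_left)
      also have "\<dots> \<le> (\<Sum>l\<in>V. ip_form U (reduced v U c)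
        (\<lambda>\<rho>. h (\<rho> \<circ> Transposition.transpose l v)) (\<lambda>\<rho>. h (\<rho> \<circ> Transposition.transpose l v)))"
        by (rule sum_mono) (rule IH)
      also have "\<dots> \<le> ip_form V c h h"
        unfolding U_def by (rule ip_form_removal[OF V v]) (use sym nonneg legs3 U_def in auto)
      finally show "r * (\<Sum>\<sigma> | \<sigma> permutes V. (h \<sigma>)\<^sup>2) \<le> ip_form V c h h" .
    qed
  qed
qed

section \<open>Nested triangulations\<close>

text \<open>The size function of the datatype supplies the order of removal: a vertex outranks the
  members of the triangle into which it was put.\<close>

lemma size_lt_Nested:
  assumes "v |\<in>| t"
  shows "size v < size (Nested t k)"
proof -
  have "Suc (size v) \<le> (\<Sum>x\<in>fset t. Suc (size x))"
    using assms by (intro member_le_sum) auto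
  then show ?thesis by (simp add: size_fset_simps)
qed

definition corners :: "vertex set" where
  "corners = {Corner 0, Corner 1, Corner 2}"

text \<open>An edge not between corners joins a nested vertex to a member of the triangle in its
  name, so lower neighbours can be read off the name of a vertex. Triangles survive the addition of
  edges, so the invariant persists for any chosen set of triangles.\<close>

definition nested_structure :: "graph \<Rightarrow> bool" where
  "nested_structure G \<longleftrightarrow>
    corners \<subseteq> fst G \<and> (\<forall>u\<in>corners. \<forall>v\<in>corners. u \<noteq> v \<longrightarrow> {u, v} \<in> snd G) \<and>
    (\<forall>e\<in>snd G. e \<subseteq> corners \<or> (\<exists>t k v. v |\<in>| t \<and> e = {Nested t k, v})) \<and>
    (\<forall>u\<in>fst G. u \<in> corners \<or> (\<exists>t k. u = Nested t k \<and> t \<in> triangles G))"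

lemma nested_structureD:
  assumes "nested_structure G"
  shows "corners \<subseteq> fst G"
    and "u \<in> corners \<Longrightarrow> v \<in> corners \<Longrightarrow> u \<noteq> v \<Longrightarrow> {u, v} \<in> snd G"
    and "e \<in> snd G \<Longrightarrow> e \<subseteq> corners \<or> (\<exists>t k v. v |\<in>| t \<and> e = {Nested t k, v})"
    and "u \<in> fst G \<Longrightarrow> u \<in> corners \<or> (\<exists>t k. u = Nested t k \<and> t \<in> triangles G)"
  using assms unfolding nested_structure_def by simp_all

lemma nested_structure_add_nested:
  assumes G: "nested_structure G" and \<Delta>: "\<Delta> \<subseteq> triangles G"
  shows "nested_structure (add_nested N \<Delta> G)"
proof -
  have tri: "triangles G \<subseteq> triangles (add_nested N \<Delta> G)"
    unfolding triangles_def add_nested_def by auto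
  show ?thesis
    unfolding nested_structure_def
  proof (intro conjI ballI impI)
    show "corners \<subseteq> fst (add_nested N \<Delta> G)"
      using nested_structureD(1)[OF G] unfolding add_nested_def by auto
    show "{u, v} \<in> snd (add_nested N \<Delta> G)" if "u \<in> corners" "v \<in> corners" "u \<noteq> v" for u v
      using nested_structureD(2)[OF G that] unfolding add_nested_def by simp
    show "e \<subseteq> corners \<or> (\<exists>t k v. v |\<in>| t \<and> e = {Nested t k, v})" if "e \<in> snd (add_nested N \<Delta> G)" for e
    proof (cases "e \<in> snd G")
      case True
      then show ?thesis by (rule nested_structureD(3)[OF G])
    next
      case False
      then show ?thesis using that unfolding add_nested_def by auto
    qed
    show "u \<in> corners \<or> (\<exists>t k. u = Nested t k \<and> t \<in> triangles (add_nested N \<Delta> G))"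
      if "u \<in> fst (add_nested N \<Delta> G)" for u
    proof (cases "u \<in> fst G")
      case True
      then show ?thesis using nested_structureD(4)[OF G True] tri by auto
    next
      case False
      then show ?thesis using that tri \<Delta> unfolding add_nested_def by auto
    qed
  qed
qed

lemma nested_structure_nested_triangulation: "nested_structure (nested_triangulation D N)"
proof (induction D N rule: nested_triangulation.induct)
  case (1 N)
  show ?case unfolding nested_structure_def corners_def by (auto simp: doubleton_eq_iff)
next
  case (2 N)
  show ?case unfolding nested_triangulation.simps(2)
    by (rule nested_structure_add_nested[OF 2(1)]) simp
next
  case (3 i N)
  show ?case unfolding nested_triangulation.simps(3)
    by (rule nested_structure_add_nested[OF 3(1)]) auto
qed

text \<open>The lower neighbours of a nested vertex lie in its own triangle, and those of a corner
  among the corners; either is a clique of three vertices.\<close>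

lemma nested_structure_lower_neighbours:
  assumes G: "nested_structure G" and v: "v \<in> fst G"
  defines "L \<equiv> {x. x \<noteq> v \<and> {v, x} \<in> snd G \<and> size x \<le> size v}"
  shows "finite L" "card L \<le> 3" "\<And>x y. x \<in> L \<Longrightarrow> y \<in> L \<Longrightarrow> x \<noteq> y \<Longrightarrow> {x, y} \<in> snd G"
proof -
  have above: "\<exists>k t. v = Nested t k \<and> x |\<in>| t" if "x \<in> L" "\<not> {v, x} \<subseteq> corners" for x
  proof -
    from that have "{v, x} \<in> snd G" "size x \<le> size v" unfolding L_def by auto
    from nested_structureD(3)[OF G this(1)] that(2)
    obtain t k u where tk: "u |\<in>| t" "{v, x} = {Nested t k, u}" by auto
    \<comment> \<open>In the other orientation \<open>x\<close> would exceed \<open>v\<close> in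
      size.\<close>
    have "\<not> (x = Nested t k \<and> v = u)"
      using size_lt_Nested[OF tk(1), of k] \<open>size x \<le> size v\<close> by auto
    with tk(2) have "v = Nested t k" "x = u" by (auto simp: doubleton_eq_iff)
    with tk(1) show ?thesis by blast
  qed
  have "\<exists>T. finite T \<and> card T \<le> 3 \<and> L \<subseteq> T \<and> (\<forall>x\<in>T. \<forall>y\<in>T. x \<noteq> y \<longrightarrow> {x, y} \<in> snd G)"
  proof (cases "v \<in> corners")
    case True
    then have "x \<in> corners" if "x \<in> L" for x
      using above[OF that] unfolding corners_def by auto
    moreover have "finite corners" "card corners \<le> 3" unfolding corners_def by (auto simp: card_insert_if)
    ultimately show ?thesis using nested_structureD(2)[OF G] by (intro exI[of _ corners]) auto
  next
    case False
    then obtain t k where v_def: "v = Nested t k" and t: "t \<in> triangles G"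
      using nested_structureD(4)[OF G v] by blast
    have "L \<subseteq> fset t" using above False v_def by auto
    moreover have "card (fset t) = 3" using t unfolding triangles_def fcard.rep_eq by simp
    moreover have "\<forall>x\<in>fset t. \<forall>y\<in>fset t. x \<noteq> y \<longrightarrow> {x, y} \<in> snd G"
      using t unfolding triangles_def by auto
    ultimately show ?thesis by (intro exI[of _ "fset t"]) auto
  qed
  then obtain T where T: "finite T" "card T \<le> 3" "L \<subseteq> T" "\<forall>x\<in>T. \<forall>y\<in>T. x \<noteq> y \<longrightarrow> {x, y} \<in> snd G"
    by blast
  show "finite L" using T finite_subset by blast
  show "card L \<le> 3" using T card_mono[of T L] by linarith
  show "\<And>x y. x \<in> L \<Longrightarrow> y \<in> L \<Longrightarrow> x \<noteq> y \<Longrightarrow> {x, y} \<in> snd G" using T by blast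
qed

section \<open>Laplacian matrices and Dirichlet forms\<close>

lemma sum_pairs_less:
  fixes H :: "nat \<Rightarrow> nat \<Rightarrow> real"
  assumes "\<And>x y. x < n \<Longrightarrow> y < n \<Longrightarrow> H x y = H y x" "\<And>x. x < n \<Longrightarrow> H x x = 0"
  shows "(\<Sum>x<n. \<Sum>y<n. H x y) = 2 * (\<Sum>(x, y) | x < y \<and> y < n. H x y)"
proof -
  let ?P = "{(x, y). x < y \<and> y < n}"
  have fin: "finite ?P" by (rule finite_subset[of _ "{..<n} \<times> {..<n}"]) auto
  have "(\<Sum>x<n. \<Sum>y<n. H x y) = (\<Sum>(x, y)\<in>{..<n} \<times> {..<n}. H x y)"
    by (simp add: sum.cartesian_product)
  also have "\<dots> = (\<Sum>(x, y)\<in>?P \<union> prod.swap ` ?P. H x y)"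
    by (rule sum.mono_neutral_right) (use assms(2) in \<open>auto simp: image_iff not_less_iff_gr_or_eq\<close>)
  also have "\<dots> = (\<Sum>(x, y)\<in>?P. H x y) + (\<Sum>(x, y)\<in>prod.swap ` ?P. H x y)"
    by (rule sum.union_disjoint) (use fin in auto)
  also have "(\<Sum>(x, y)\<in>prod.swap ` ?P. H x y) = (\<Sum>(x, y)\<in>?P. H x y)"
    by (subst sum.reindex) (auto intro!: sum.cong assms(1) simp: inj_on_def)
  finally show ?thesis by simp
qed

lemma rw_laplacian_mult:
  assumes "f \<in> carrier_vec n" "i < n" and "\<And>i j. i < n \<Longrightarrow> j < n \<Longrightarrow> \<alpha> i j = \<alpha> j i"
  shows "(rw_laplacian n \<alpha> *\<^sub>v f) $ i = (\<Sum>j<n. \<alpha> i j * (f $ i - f $ j))"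
proof -
  have "(rw_laplacian n \<alpha> *\<^sub>v f) $ i =
    (\<Sum>j<n. (if i = j then (\<Sum>k\<in>{..<n} - {j}. \<alpha> k j) else - \<alpha> i j) * f $ j)"
    using assms(1,2) unfolding rw_laplacian_def by (simp add: scalar_prod_def atLeast0LessThan)
  also have "\<dots> = (\<Sum>k\<in>{..<n} - {i}. \<alpha> k i) * f $ i + (\<Sum>j\<in>{..<n} - {i}. - \<alpha> i j * f $ j)"
    using assms(2) by (subst sum.remove[of _ i]) (auto intro!: sum.cong)
  also have "\<dots> = (\<Sum>j\<in>{..<n} - {i}. \<alpha> i j * (f $ i - f $ j))"
    using assms(2,3) by (simp add: sum_distrib_right right_diff_distrib sum_subtractf sum_negf)
  also have "\<dots> = (\<Sum>j<n. \<alpha> i j * (f $ i - f $ j))"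
    by (rule sum.mono_neutral_left) auto
  finally show ?thesis .
qed

lemma rw_laplacian_form:
  assumes f: "f \<in> carrier_vec n" and sym: "\<And>i j. i < n \<Longrightarrow> j < n \<Longrightarrow> \<alpha> i j = \<alpha> j i"
  shows "f \<bullet> (rw_laplacian n \<alpha> *\<^sub>v f) = rw_form {..<n} \<alpha> (\<lambda>i. f $ i) (\<lambda>i. f $ i)"
proof -
  let ?F = "\<lambda>i j. \<alpha> i j * (f $ i * (f $ i - f $ j))"
  have "dim_vec (rw_laplacian n \<alpha> *\<^sub>v f) = n" unfolding rw_laplacian_def by simp
  then have "f \<bullet> (rw_laplacian n \<alpha> *\<^sub>v f) = (\<Sum>i<n. f $ i * (\<Sum>j<n. \<alpha> i j * (f $ i - f $ j)))"
    unfolding scalar_prod_def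
    by (auto simp: atLeast0LessThan rw_laplacian_mult[OF f _ sym] simp del: index_mult_mat_vec intro!: sum.cong)
  also have "\<dots> = (\<Sum>i<n. \<Sum>j<n. ?F i j)"
    by (simp add: sum_distrib_left mult.left_commute)
  finally have 1: "f \<bullet> (rw_laplacian n \<alpha> *\<^sub>v f) = (\<Sum>i<n. \<Sum>j<n. ?F i j)" .
  have 2: "(\<Sum>i<n. \<Sum>j<n. ?F i j) = (\<Sum>i<n. \<Sum>j<n. ?F j i)"
    by (rule sum.swap)
  have "(\<Sum>i<n. \<Sum>j<n. ?F i j) + (\<Sum>i<n. \<Sum>j<n. ?F j i) =
    (\<Sum>i<n. \<Sum>j<n. \<alpha> i j * ((f $ i - f $ j) * (f $ i - f $ j)))"
    unfolding sum.distrib[symmetric] by (intro sum.cong refl) (simp add: sym algebra_simps)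
  then show ?thesis unfolding rw_form_def 1 using 2 by simp
qed

lemma rw_form_nonneg:
  assumes "\<And>x y. x \<in> V \<Longrightarrow> y \<in> V \<Longrightarrow> 0 \<le> c x y"
  shows "0 \<le> rw_form V c g g"
  unfolding rw_form_def using assms
  by (intro divide_nonneg_nonneg sum_nonneg mult_nonneg_nonneg[OF _ zero_le_square]) auto

lemma ip_form_nonneg:
  assumes "\<And>x y. x \<in> V \<Longrightarrow> y \<in> V \<Longrightarrow> 0 \<le> c x y"
  shows "0 \<le> ip_form V c f f"
proof -
  have "0 \<le> (\<Sum>\<sigma> | \<sigma> permutes V. f \<sigma> * (f \<sigma> - f (Transposition.transpose x y \<circ> \<sigma>)))"
    if "x \<in> V" "y \<in> V" for x y
  proof -
    let ?t = "Transposition.transpose x y"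
    have "0 \<le> (\<Sum>\<sigma> | \<sigma> permutes V. (f \<sigma> - f (?t \<circ> \<sigma>))\<^sup>2)" by (rule sum_nonneg) simp
    moreover have "(\<Sum>\<sigma> | \<sigma> permutes V. (f \<sigma> - f (?t \<circ> \<sigma>))\<^sup>2) =
       (\<Sum>\<sigma> | \<sigma> permutes V. f (?t \<circ> \<sigma>) * f (?t \<circ> \<sigma>)) + (\<Sum>\<sigma> | \<sigma> permutes V. f \<sigma> * f \<sigma>)
       - 2 * (\<Sum>\<sigma> | \<sigma> permutes V. f \<sigma> * f (?t \<circ> \<sigma>))"
      by (simp add: power2_eq_square algebra_simps sum.distrib sum_subtractf sum_distrib_left)
    moreover have "(\<Sum>\<sigma> | \<sigma> permutes V. f (?t \<circ> \<sigma>) * f (?t \<circ> \<sigma>)) = (\<Sum>\<sigma> | \<sigma> permutes V. f \<sigma> * f \<sigma>)"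
      by (rule sum_permutes_shift[OF permutes_swap_id[OF that]])
    moreover have "(\<Sum>\<sigma> | \<sigma> permutes V. f \<sigma> * (f \<sigma> - f (?t \<circ> \<sigma>))) =
       (\<Sum>\<sigma> | \<sigma> permutes V. f \<sigma> * f \<sigma>) - (\<Sum>\<sigma> | \<sigma> permutes V. f \<sigma> * f (?t \<circ> \<sigma>))"
      by (simp add: right_diff_distrib sum_subtractf)
    ultimately show ?thesis by linarith
  qed
  then have "0 \<le> c x y * (\<Sum>\<sigma> | \<sigma> permutes V. f \<sigma> * (f \<sigma> - f (Transposition.transpose x y \<circ> \<sigma>)))"
    if "x \<in> V" "y \<in> V" for x y
    using assms that by (intro mult_nonneg_nonneg)
  then show ?thesis unfolding ip_form_def by (intro divide_nonneg_nonneg sum_nonneg) auto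
qed

text \<open>A transposition of distinct indices is not the identity, and a surjective \<sigma> can
  be cancelled on the right. So the off-diagonal sum vanishes on the diagonal, and the case
  distinction disappears.\<close>

lemma interchange_entry_altdef:
  assumes surj: "surj \<sigma>"
  shows "interchange_entry n \<alpha> \<sigma> \<sigma>' = of_bool (\<sigma>' = \<sigma>) * (\<Sum>(i, j) | i < j \<and> j < n. \<alpha> i j) -
    (\<Sum>(i, j) | i < j \<and> j < n. of_bool (\<sigma>' = Transposition.transpose i j \<circ> \<sigma>) * \<alpha> i j)"
proof -
  let ?P = "{(i, j). i < j \<and> j < n}"
  have fin: "finite ?P" by (rule finite_subset[of _ "{..<n} \<times> {..<n}"]) auto
  have "(\<Sum>(i, j) | i < j \<and> j < n. of_bool (\<sigma>' = Transposition.transpose i j \<circ> \<sigma>) * \<alpha> i j) =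
    (\<Sum>(i, j) | i < j \<and> j < n \<and> \<sigma>' = Transposition.transpose i j \<circ> \<sigma>. \<alpha> i j)"
    by (rule sum.mono_neutral_cong_right) (use fin in auto)
  moreover have "\<sigma> \<noteq> Transposition.transpose i j \<circ> \<sigma>" if "i < j" "j < n" for i j
  proof
    assume "\<sigma> = Transposition.transpose i j \<circ> \<sigma>"
    then have "id \<circ> \<sigma> = Transposition.transpose i j \<circ> \<sigma>" by simp
    with surj have "id = Transposition.transpose i j" by (metis surj_fun_eq)
    then show False using that by (metis nat_neq_iff transpose_eq_id_iff)
  qed
  then have "(\<Sum>(i, j) | i < j \<and> j < n. of_bool (\<sigma> = Transposition.transpose i j \<circ> \<sigma>) * \<alpha> i j) = 0"
    by (intro sum.neutral) auto
  ultimately show ?thesis unfolding interchange_entry_def by auto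
qed


section \<open>Both spectral gaps as thresholds of Dirichlet forms\<close>

locale weighted_interchange =
  fixes n :: nat and \<alpha> :: "nat \<Rightarrow> nat \<Rightarrow> real" and \<pi> :: "nat \<Rightarrow> nat \<Rightarrow> nat"
  assumes bij: "bij_betw \<pi> {..<fact n} {\<sigma>. \<sigma> permutes {..<n}}"
    and sym: "\<And>i j. i < n \<Longrightarrow> j < n \<Longrightarrow> \<alpha> i j = \<alpha> j i"
    and nonneg: "\<And>i j. i < n \<Longrightarrow> j < n \<Longrightarrow> \<alpha> i j \<ge> 0"
    and two: "2 \<le> n"
begin

lemma perm: "r < fact n \<Longrightarrow> \<pi> r permutes {..<n}"
  using bij bij_betwE by fastforce

lemma sum_enum: "(\<Sum>r<fact n. F (\<pi> r)) = (\<Sum>\<sigma> | \<sigma> permutes {..<n}. F \<sigma>)"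
  by (rule sum.reindex_bij_betw[OF bij])

text \<open>Turns vectors into functions on permutations, which removes the enumeration \<pi> from
  the forms. Values outside the permutations of \<open>{..<n}\<close> carry no meaning.\<close>

definition vec_fun :: "real vec \<Rightarrow> (nat \<Rightarrow> nat) \<Rightarrow> real" where
  "vec_fun f \<sigma> = f $ inv_into {..<fact n} \<pi> \<sigma>"

lemma vec_fun_enum: "r < fact n \<Longrightarrow> vec_fun f (\<pi> r) = f $ r"
  unfolding vec_fun_def using bij by (simp add: bij_betw_def)

lemma vec_fun_surj: "\<exists>f\<in>carrier_vec (fact n). \<forall>\<sigma>. \<sigma> permutes {..<n} \<longrightarrow> vec_fun f \<sigma> = F \<sigma>"
proof (intro bexI allI impI)
  fix \<sigma> assume \<sigma>: "\<sigma> permutes {..<n}"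
  then have "inv_into {..<fact n} \<pi> \<sigma> < fact n" "\<pi> (inv_into {..<fact n} \<pi> \<sigma>) = \<sigma>"
    using bij inv_into_into[of \<sigma> \<pi> "{..<fact n}"] by (auto simp: bij_betw_def f_inv_into_f)
  then show "vec_fun (vec (fact n) (\<lambda>r. F (\<pi> r))) \<sigma> = F \<sigma>" unfolding vec_fun_def by simp
qed simp

lemma interchange_laplacian_mult:
  assumes f: "f \<in> carrier_vec (fact n)" and r: "r < fact n"
  shows "(interchange_laplacian n \<alpha> \<pi> *\<^sub>v f) $ r =
    (\<Sum>(i, j) | i < j \<and> j < n. \<alpha> i j * (vec_fun f (\<pi> r) - vec_fun f (Transposition.transpose i j \<circ> \<pi> r)))"
proof -
  let ?P = "{(i, j). i < j \<and> j < n}" and ?S = "{\<sigma>. \<sigma> permutes {..<n}}"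
  let ?t = "\<lambda>i j. Transposition.transpose i j \<circ> \<pi> r"
  have fin: "finite ?P" by (rule finite_subset[of _ "{..<n} \<times> {..<n}"]) auto
  have finS: "finite ?S" by (rule finite_permutations) simp
  have surj: "surj (\<pi> r)" using perm[OF r] permutes_surj by blast
  have delta: "(\<Sum>\<sigma>\<in>?S. of_bool (\<sigma> = \<tau>) * vec_fun f \<sigma>) = vec_fun f \<tau>" if "\<tau> permutes {..<n}" for \<tau>
    using that finS by (subst sum.remove[of _ \<tau>]) (auto intro!: sum.neutral)
  have "(interchange_laplacian n \<alpha> \<pi> *\<^sub>v f) $ r = (\<Sum>k<fact n. interchange_entry n \<alpha> (\<pi> r) (\<pi> k) * vec_fun f (\<pi> k))"
    using f r unfolding interchange_laplacian_def by (simp add: scalar_prod_def atLeast0LessThan vec_fun_enum)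
  also have "\<dots> = (\<Sum>\<sigma>\<in>?S. interchange_entry n \<alpha> (\<pi> r) \<sigma> * vec_fun f \<sigma>)"
    by (rule sum_enum)
  also have "\<dots> = (\<Sum>\<sigma>\<in>?S. (\<Sum>(i, j)\<in>?P. \<alpha> i j) * (of_bool (\<sigma> = \<pi> r) * vec_fun f \<sigma>) -
    (\<Sum>(i, j)\<in>?P. \<alpha> i j * (of_bool (\<sigma> = ?t i j) * vec_fun f \<sigma>)))"
  proof (rule sum.cong[OF refl])
    fix \<sigma>
    have "(\<Sum>(i, j)\<in>?P. of_bool (\<sigma> = ?t i j) * \<alpha> i j) * vec_fun f \<sigma> =
        (\<Sum>(i, j)\<in>?P. \<alpha> i j * (of_bool (\<sigma> = ?t i j) * vec_fun f \<sigma>))"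
      unfolding sum_distrib_right by (intro sum.cong refl) (auto simp: ac_simps)
    then show "interchange_entry n \<alpha> (\<pi> r) \<sigma> * vec_fun f \<sigma> = (\<Sum>(i, j)\<in>?P. \<alpha> i j) * (of_bool (\<sigma> = \<pi> r) * vec_fun f \<sigma>) -
        (\<Sum>(i, j)\<in>?P. \<alpha> i j * (of_bool (\<sigma> = ?t i j) * vec_fun f \<sigma>))"
      unfolding interchange_entry_altdef[OF surj] left_diff_distrib by (simp only: ac_simps)
  qed
  also have "\<dots> = (\<Sum>(i, j)\<in>?P. \<alpha> i j) * (\<Sum>\<sigma>\<in>?S. of_bool (\<sigma> = \<pi> r) * vec_fun f \<sigma>) -
    (\<Sum>\<sigma>\<in>?S. \<Sum>(i, j)\<in>?P. \<alpha> i j * (of_bool (\<sigma> = ?t i j) * vec_fun f \<sigma>))"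
    by (simp only: sum_subtractf sum_distrib_left)
  also have "(\<Sum>\<sigma>\<in>?S. of_bool (\<sigma> = \<pi> r) * vec_fun f \<sigma>) = vec_fun f (\<pi> r)"
    by (rule delta[OF perm[OF r]])
  also have "(\<Sum>\<sigma>\<in>?S. \<Sum>(i, j)\<in>?P. \<alpha> i j * (of_bool (\<sigma> = ?t i j) * vec_fun f \<sigma>)) =
    (\<Sum>(i, j)\<in>?P. \<alpha> i j * (\<Sum>\<sigma>\<in>?S. of_bool (\<sigma> = ?t i j) * vec_fun f \<sigma>))"
    unfolding sum_distrib_left case_prod_unfold by (rule sum.swap)
  also have "\<dots> = (\<Sum>(i, j)\<in>?P. \<alpha> i j * vec_fun f (?t i j))"
    by (intro sum.cong refl) (auto intro!: delta permutes_compose[OF perm[OF r]] permutes_swap_id)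
  finally show ?thesis
    by (simp add: right_diff_distrib sum_subtractf sum_distrib_right case_prod_unfold)
qed

lemma interchange_laplacian_form:
  assumes f: "f \<in> carrier_vec (fact n)"
  shows "f \<bullet> (interchange_laplacian n \<alpha> \<pi> *\<^sub>v f) = ip_form {..<n} \<alpha> (vec_fun f) (vec_fun f)"
proof -
  let ?P = "{(i, j). i < j \<and> j < n}"
  let ?D = "\<lambda>i j. \<Sum>\<sigma> | \<sigma> permutes {..<n}. vec_fun f \<sigma> * (vec_fun f \<sigma> - vec_fun f (Transposition.transpose i j \<circ> \<sigma>))"
  have "dim_vec (interchange_laplacian n \<alpha> \<pi> *\<^sub>v f) = fact n" unfolding interchange_laplacian_def by simp
  then have "f \<bullet> (interchange_laplacian n \<alpha> \<pi> *\<^sub>v f) =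
    (\<Sum>r<fact n. f $ r * (interchange_laplacian n \<alpha> \<pi> *\<^sub>v f) $ r)"
    unfolding scalar_prod_def by (simp add: atLeast0LessThan)
  also have "\<dots> = (\<Sum>r<fact n. vec_fun f (\<pi> r) *
      (\<Sum>(i, j)\<in>?P. \<alpha> i j * (vec_fun f (\<pi> r) - vec_fun f (Transposition.transpose i j \<circ> \<pi> r))))"
    by (intro sum.cong refl) (simp only: lessThan_iff interchange_laplacian_mult[OF f] vec_fun_enum)
  also have "\<dots> = (\<Sum>\<sigma> | \<sigma> permutes {..<n}. vec_fun f \<sigma> *
      (\<Sum>(i, j)\<in>?P. \<alpha> i j * (vec_fun f \<sigma> - vec_fun f (Transposition.transpose i j \<circ> \<sigma>))))"
    by (rule sum_enum)
  also have "\<dots> = (\<Sum>(i, j)\<in>?P. \<alpha> i j * ?D i j)"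
    unfolding sum_distrib_left case_prod_unfold
    by (subst sum.swap) (simp add: mult.left_commute)
  also have "\<dots> = (\<Sum>i<n. \<Sum>j<n. \<alpha> i j * ?D i j) / 2"
    by (subst sum_pairs_less) (auto simp: sym transpose_commute)
  finally show ?thesis unfolding ip_form_def .
qed

lemma interchange_gap_iff:
  "r \<le> spectral_gap (interchange_laplacian n \<alpha> \<pi>) \<longleftrightarrow>
    (\<forall>F. (\<Sum>\<sigma> | \<sigma> permutes {..<n}. F \<sigma>) = 0 \<longrightarrow>
      r * (\<Sum>\<sigma> | \<sigma> permutes {..<n}. (F \<sigma>)\<^sup>2) \<le> ip_form {..<n} \<alpha> F F)"
proof -
  let ?A = "interchange_laplacian n \<alpha> \<pi>"
  have A: "?A \<in> carrier_mat (fact n) (fact n)" unfolding interchange_laplacian_def by simp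
  have "(2 :: nat) \<le> fact n" using fact_mono_nat[OF two] by (simp add: numeral_2_eq_2)
  moreover have "?A\<^sup>T = ?A"
  proof (rule eq_matI)
    fix r c assume "r < dim_row ?A" "c < dim_col ?A"
    then have rc: "r < fact n" "c < fact n" using A by auto
    then have surj: "surj (\<pi> r)" "surj (\<pi> c)" using perm permutes_surj by blast+
    \<comment> \<open>Transpositions are involutions, so the condition for an off-diagonal
      contribution is symmetric.\<close>
    have "(\<pi> r = Transposition.transpose i j \<circ> \<pi> c) = (\<pi> c = Transposition.transpose i j \<circ> \<pi> r)" for i j
      by (metis comp_assoc transpose_comp_involutory id_comp)
    then have "interchange_entry n \<alpha> (\<pi> c) (\<pi> r) = interchange_entry n \<alpha> (\<pi> r) (\<pi> c)"
      unfolding interchange_entry_altdef[OF surj(1)] interchange_entry_altdef[OF surj(2)]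
      by (simp add: eq_commute[of "\<pi> r" "\<pi> c"])
    then show "?A\<^sup>T $$ (r, c) = ?A $$ (r, c)"
      using rc unfolding interchange_laplacian_def by simp
  qed (use A in auto)
  moreover have "0 \<le> f \<bullet> (?A *\<^sub>v f)" if "f \<in> carrier_vec (fact n)" for f
    unfolding interchange_laplacian_form[OF that] by (rule ip_form_nonneg) (use nonneg in auto)
  moreover have "?A *\<^sub>v vec (fact n) (\<lambda>_. 1) = 0\<^sub>v (fact n)"
  proof (rule eq_vecI)
    fix r assume "r < dim_vec (0\<^sub>v (fact n) :: real vec)"
    then have r: "r < fact n" by simp
    have "vec_fun (vec (fact n) (\<lambda>_. 1)) \<sigma> = 1" if "\<sigma> permutes {..<n}" for \<sigma>
      unfolding vec_fun_def using bij inv_into_into[of \<sigma> \<pi> "{..<fact n}"] that by (simp add: bij_betw_def)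
    moreover have "Transposition.transpose i j \<circ> \<pi> r permutes {..<n}" if "i < j" "j < n" for i j
      using that by (intro permutes_compose[OF perm[OF r]] permutes_swap_id) auto
    ultimately show "(?A *\<^sub>v vec (fact n) (\<lambda>_. 1)) $ r = 0\<^sub>v (fact n) $ r"
      using r perm[OF r] unfolding interchange_laplacian_mult[OF vec_carrier r]
      by (auto intro!: sum.neutral)
  qed (use A in auto)
  ultimately have "r \<le> spectral_gap ?A \<longleftrightarrow>
    (\<forall>f\<in>carrier_vec (fact n). (\<Sum>k<fact n. f $ k) = 0 \<longrightarrow> r * (f \<bullet> f) \<le> f \<bullet> (?A *\<^sub>v f))"
    using A by (intro le_spectral_gap_iff)
  also have "\<dots> \<longleftrightarrow> (\<forall>f\<in>carrier_vec (fact n). (\<Sum>\<sigma> | \<sigma> permutes {..<n}. vec_fun f \<sigma>) = 0 \<longrightarrow>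
      r * (\<Sum>\<sigma> | \<sigma> permutes {..<n}. (vec_fun f \<sigma>)\<^sup>2) \<le> ip_form {..<n} \<alpha> (vec_fun f) (vec_fun f))"
  proof (intro ball_cong refl)
    fix f :: "real vec" assume f: "f \<in> carrier_vec (fact n)"
    have "(\<Sum>k<fact n. f $ k) = (\<Sum>\<sigma> | \<sigma> permutes {..<n}. vec_fun f \<sigma>)"
      unfolding sum_enum[symmetric] by (simp add: vec_fun_enum)
    moreover have "f \<bullet> f = (\<Sum>\<sigma> | \<sigma> permutes {..<n}. (vec_fun f \<sigma>)\<^sup>2)"
      unfolding sum_enum[symmetric] using f
      by (simp add: vec_fun_enum scalar_prod_def atLeast0LessThan power2_eq_square)
    ultimately show "((\<Sum>k<fact n. f $ k) = 0 \<longrightarrow> r * (f \<bullet> f) \<le> f \<bullet> (?A *\<^sub>v f)) =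
      ((\<Sum>\<sigma> | \<sigma> permutes {..<n}. vec_fun f \<sigma>) = 0 \<longrightarrow>
        r * (\<Sum>\<sigma> | \<sigma> permutes {..<n}. (vec_fun f \<sigma>)\<^sup>2) \<le> ip_form {..<n} \<alpha> (vec_fun f) (vec_fun f))"
      by (simp only: interchange_laplacian_form[OF f])
  qed
  also have "\<dots> \<longleftrightarrow> (\<forall>F. (\<Sum>\<sigma> | \<sigma> permutes {..<n}. F \<sigma>) = 0 \<longrightarrow>
      r * (\<Sum>\<sigma> | \<sigma> permutes {..<n}. (F \<sigma>)\<^sup>2) \<le> ip_form {..<n} \<alpha> F F)"
  proof (intro iffI ballI allI)
    fix F assume *: "\<forall>f\<in>carrier_vec (fact n). (\<Sum>\<sigma> | \<sigma> permutes {..<n}. vec_fun f \<sigma>) = 0 \<longrightarrow>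
      r * (\<Sum>\<sigma> | \<sigma> permutes {..<n}. (vec_fun f \<sigma>)\<^sup>2) \<le> ip_form {..<n} \<alpha> (vec_fun f) (vec_fun f)"
    obtain f where f: "f \<in> carrier_vec (fact n)" "\<And>\<sigma>. \<sigma> permutes {..<n} \<Longrightarrow> vec_fun f \<sigma> = F \<sigma>"
      using vec_fun_surj by blast
    \<comment> \<open>The form evaluates functions only at permutations, so agreement of
      \<open>vec_fun f\<close> and \<open>F\<close> there is enough.\<close>
    have "vec_fun f (Transposition.transpose i j \<circ> \<sigma>) = F (Transposition.transpose i j \<circ> \<sigma>)"
      if "\<sigma> permutes {..<n}" "i < n" "j < n" for i j \<sigma>
      by (intro f(2) permutes_compose that permutes_swap_id) (use that in auto)
    then have "ip_form {..<n} \<alpha> (vec_fun f) (vec_fun f) = ip_form {..<n} \<alpha> F F"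
      unfolding ip_form_def using f(2) by simp
    with *[rule_format, OF f(1)] f(2) show "(\<Sum>\<sigma> | \<sigma> permutes {..<n}. F \<sigma>) = 0 \<longrightarrow>
      r * (\<Sum>\<sigma> | \<sigma> permutes {..<n}. (F \<sigma>)\<^sup>2) \<le> ip_form {..<n} \<alpha> F F"
      by simp
  qed blast
  finally show ?thesis .
qed

lemma rw_gap_iff:
  "r \<le> spectral_gap (rw_laplacian n \<alpha>) \<longleftrightarrow>
    (\<forall>g. (\<Sum>x<n. g x) = 0 \<longrightarrow> r * (\<Sum>x<n. (g x)\<^sup>2) \<le> rw_form {..<n} \<alpha> g g)"
proof -
  let ?A = "rw_laplacian n \<alpha>"
  have A: "?A \<in> carrier_mat n n" unfolding rw_laplacian_def by simp
  have form: "f \<bullet> (?A *\<^sub>v f) = rw_form {..<n} \<alpha> (\<lambda>i. f $ i) (\<lambda>i. f $ i)" if "f \<in> carrier_vec n" for f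
    by (rule rw_laplacian_form[OF that]) (rule sym)
  have "r \<le> spectral_gap ?A \<longleftrightarrow>
    (\<forall>f\<in>carrier_vec n. (\<Sum>k<n. f $ k) = 0 \<longrightarrow> r * (f \<bullet> f) \<le> f \<bullet> (?A *\<^sub>v f))"
  proof (rule le_spectral_gap_iff[OF A two])
    show "?A\<^sup>T = ?A" by (rule eq_matI) (use sym in \<open>auto simp: rw_laplacian_def\<close>)
    show "0 \<le> f \<bullet> (?A *\<^sub>v f)" if "f \<in> carrier_vec n" for f
      unfolding form[OF that] by (rule rw_form_nonneg) (use nonneg in auto)
    show "?A *\<^sub>v vec n (\<lambda>_. 1) = 0\<^sub>v n"
    proof (rule eq_vecI)
      fix i assume "i < dim_vec (0\<^sub>v n :: real vec)"
      then have "i < n" by simp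
      then show "(?A *\<^sub>v vec n (\<lambda>_. 1)) $ i = 0\<^sub>v n $ i"
        by (subst rw_laplacian_mult[OF vec_carrier \<open>i < n\<close>]) (auto intro: sym)
    qed (use A in auto)
  qed
  also have "\<dots> \<longleftrightarrow> (\<forall>f\<in>carrier_vec n. (\<Sum>k<n. f $ k) = 0 \<longrightarrow>
      r * (\<Sum>k<n. (f $ k)\<^sup>2) \<le> rw_form {..<n} \<alpha> (\<lambda>i. f $ i) (\<lambda>i. f $ i))"
  proof (intro ball_cong refl)
    fix f :: "real vec" assume f: "f \<in> carrier_vec n"
    have "f \<bullet> f = (\<Sum>k<n. (f $ k)\<^sup>2)"
      using f by (simp add: scalar_prod_def atLeast0LessThan power2_eq_square)
    then show "((\<Sum>k<n. f $ k) = 0 \<longrightarrow> r * (f \<bullet> f) \<le> f \<bullet> (?A *\<^sub>v f)) =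
      ((\<Sum>k<n. f $ k) = 0 \<longrightarrow> r * (\<Sum>k<n. (f $ k)\<^sup>2) \<le> rw_form {..<n} \<alpha> (\<lambda>i. f $ i) (\<lambda>i. f $ i))"
      by (simp only: form[OF f])
  qed
  also have "\<dots> \<longleftrightarrow> (\<forall>g. (\<Sum>x<n. g x) = 0 \<longrightarrow> r * (\<Sum>x<n. (g x)\<^sup>2) \<le> rw_form {..<n} \<alpha> g g)"
  proof (intro iffI ballI allI)
    fix g assume *: "\<forall>f\<in>carrier_vec n. (\<Sum>k<n. f $ k) = 0 \<longrightarrow>
      r * (\<Sum>k<n. (f $ k)\<^sup>2) \<le> rw_form {..<n} \<alpha> (\<lambda>i. f $ i) (\<lambda>i. f $ i)"
    have "rw_form {..<n} \<alpha> (\<lambda>i. vec n g $ i) (\<lambda>i. vec n g $ i) = rw_form {..<n} \<alpha> g g"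
      unfolding rw_form_def by simp
    with *[rule_format, of "vec n g"]
    show "(\<Sum>x<n. g x) = 0 \<longrightarrow> r * (\<Sum>x<n. (g x)\<^sup>2) \<le> rw_form {..<n} \<alpha> g g" by simp
  qed blast
  finally show ?thesis .
qed

text \<open>The test functions depend on the position of label 0 alone: their sum of squares and
  their energy are both (n - 1)! times those of the random walk.\<close>

lemma interchange_gap_le: "spectral_gap (interchange_laplacian n \<alpha> \<pi>) \<le> spectral_gap (rw_laplacian n \<alpha>)"
proof -
  let ?r = "spectral_gap (interchange_laplacian n \<alpha> \<pi>)"
  have ip: "?r * (\<Sum>\<sigma> | \<sigma> permutes {..<n}. (F \<sigma>)\<^sup>2) \<le> ip_form {..<n} \<alpha> F F"
    if "(\<Sum>\<sigma> | \<sigma> permutes {..<n}. F \<sigma>) = 0" for F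
    using interchange_gap_iff[of ?r] that by blast
  have "?r * (\<Sum>x<n. (g x)\<^sup>2) \<le> rw_form {..<n} \<alpha> g g" if g: "(\<Sum>x<n. g x) = 0" for g
  proof -
    have n0: "0 \<in> {..<n}" using two by simp
    have "(\<Sum>\<sigma> | \<sigma> permutes {..<n}. g (\<sigma> 0)) = 0"
      using sum_label_permutes[OF _ n0, of g] g by simp
    from ip[OF this] have "?r * (fact (n - 1) * (\<Sum>x<n. (g x)\<^sup>2)) \<le>
        ip_form {..<n} \<alpha> (\<lambda>\<sigma>. g (\<sigma> 0)) (\<lambda>\<sigma>. g (\<sigma> 0))"
      using sum_label_permutes[OF _ n0, of "\<lambda>x. (g x)\<^sup>2"] by simp
    also have "\<dots> = rw_form {..<n} \<alpha> (marginal {..<n} (\<lambda>\<sigma>. g (\<sigma> 0)) 0) g"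
      by (rule ip_form_label) (use n0 in auto)
    also have "\<dots> = fact (n - 1) * rw_form {..<n} \<alpha> g g"
      unfolding rw_form_def using n0 g
      by (simp add: marginal_label sum_distrib_left right_diff_distrib[symmetric] mult.assoc mult.left_commute[of _ "fact _"])
    finally have "fact (n - 1) * (?r * (\<Sum>x<n. (g x)\<^sup>2)) \<le> fact (n - 1) * rw_form {..<n} \<alpha> g g"
      by (simp add: mult.left_commute)
    then show ?thesis by simp
  qed
  then show ?thesis unfolding rw_gap_iff by blast
qed

end

theorem proposition8:
  fixes D N n :: nat
    and \<nu> :: "nat \<Rightarrow> vertex"
    and \<alpha> :: "nat \<Rightarrow> nat \<Rightarrow> real"
    and \<pi> :: "nat \<Rightarrow> nat \<Rightarrow> nat"
  assumes "N \<ge> 1"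
    and "bij_betw \<nu> {..<n} (fst (nested_triangulation D N))"
    and "bij_betw \<pi> {..<fact n} {\<sigma>. \<sigma> permutes {..<n}}"
    and "\<And>i j. i < n \<Longrightarrow> j < n \<Longrightarrow> \<alpha> i j = \<alpha> j i"
    and "\<And>i j. i < n \<Longrightarrow> j < n \<Longrightarrow> \<alpha> i j \<ge> 0"
    and "\<And>i j. i < n \<Longrightarrow> j < n \<Longrightarrow> {\<nu> i, \<nu> j} \<notin> snd (nested_triangulation D N) \<Longrightarrow> \<alpha> i j = 0"
    and "\<And>i j. i < n \<Longrightarrow> j < n \<Longrightarrow> (i, j) \<in> {(k, l). k < n \<and> l < n \<and> \<alpha> k l \<noteq> 0}\<^sup>*"
  shows "spectral_gap (interchange_laplacian n \<alpha> \<pi>) = spectral_gap (rw_laplacian n \<alpha>)"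
proof -
  define G where "G = nested_triangulation D N"
  have G: "nested_structure G" unfolding G_def by (rule nested_structure_nested_triangulation)
  have bij_\<nu>: "bij_betw \<nu> {..<n} (fst G)" using assms(2) unfolding G_def .
  then have "finite (fst G)" using bij_betw_finite by blast
  then have "card corners \<le> n"
    using card_mono[OF _ nested_structureD(1)[OF G]] bij_betw_same_card[OF bij_\<nu>] by simp
  \<comment> \<open>The three corners make the dimension large enough for a second eigenvalue to
    exist.\<close>
  then have "2 \<le> n" unfolding corners_def by (simp add: card_insert_if split: if_splits)
  then interpret weighted_interchange n \<alpha> \<pi>
    using assms(3,4,5) by unfold_locales auto
  \<comment> \<open>Edges and sizes are pulled back along \<nu> to the indices on which the
    Laplacians are defined.\<close>
  define E where "E i j \<longleftrightarrow> {\<nu> i, \<nu> j} \<in> snd G" for i j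
  define rk where "rk i = size (\<nu> i)" for i
  have inj: "\<nu> i = \<nu> j \<longleftrightarrow> i = j" if "i < n" "j < n" for i j
    using bij_\<nu> that unfolding bij_betw_def inj_on_def by auto
  define L where "L v = {x. x \<noteq> \<nu> v \<and> {\<nu> v, x} \<in> snd G \<and> size x \<le> size (\<nu> v)}" for v
  have vG: "\<nu> v \<in> fst G" if "v < n" for v using bij_\<nu> that bij_betwE by blast
  note L = nested_structure_lower_neighbours[OF G vG, folded L_def]
  have low: "\<nu> ` lower_neighbours E rk {..<n} v \<subseteq> L v" if "v < n" for v
    unfolding lower_neighbours_def L_def E_def rk_def using inj that by auto
  define r where "r = spectral_gap (rw_laplacian n \<alpha>)"
  have "r * (\<Sum>\<sigma> | \<sigma> permutes {..<n}. (F \<sigma>)\<^sup>2) \<le> ip_form {..<n} \<alpha> F F"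
    if "(\<Sum>\<sigma> | \<sigma> permutes {..<n}. F \<sigma>) = 0" for F
  proof (rule interchange_bound[where E = E and rk = rk])
    show "E x y" if "x \<in> {..<n}" "y \<in> {..<n}" "\<alpha> x y \<noteq> 0" for x y
      using assms(6) that unfolding E_def G_def by auto
    show "card (lower_neighbours E rk {..<n} v) \<le> 3" if v: "v \<in> {..<n}" for v
    proof -
      have "inj_on \<nu> (lower_neighbours E rk {..<n} v)"
        using bij_\<nu> unfolding bij_betw_def lower_neighbours_def by (auto intro: inj_on_subset)
      then have "card (lower_neighbours E rk {..<n} v) \<le> card (L v)"
        using low L(1) v by (intro card_inj_on_le) auto
      with L(2)[of v] v show ?thesis by simp
    qed
    show "E x y" if "v \<in> {..<n}" "x \<in> lower_neighbours E rk {..<n} v"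
      "y \<in> lower_neighbours E rk {..<n} v" "x \<noteq> y" for v x y
    proof -
      have "x < n" "y < n" using that unfolding lower_neighbours_def by auto
      then show ?thesis unfolding E_def
        using L(3)[of v "\<nu> x" "\<nu> y"] low[of v] that inj by auto
    qed
    show "r * (\<Sum>x<n. (g x)\<^sup>2) \<le> rw_form {..<n} \<alpha> g g" if "(\<Sum>x<n. g x) = 0" for g
      using rw_gap_iff[of r] that unfolding r_def by blast
  qed (use that sym nonneg in auto)
  then have "r \<le> spectral_gap (interchange_laplacian n \<alpha> \<pi>)"
    unfolding interchange_gap_iff by blast
  with interchange_gap_le show ?thesis unfolding r_def by simp
qed

end
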